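(* Let $\rho\in(\alpha_+,1)$, $p,q\in\mathcal P$, and $\alpha,\beta\in\mathcal A$. Set $$w(t):=\mathcal M_{p,\alpha}(t)-\mathcal M_{q,\beta}(t).$$ If $w\in H_\rho(0,T)$ and $\partial_t^\rho w\in L^\infty(0,T)$, then $\alpha=\beta$. Equivalently, if $\alpha\ne\beta$, then $$\partial_t^\rho\bigl(\mathcal M_{p,\alpha}-\mathcal M_{q,\beta}\bigr)\notin L^\infty(0,T).$$ In particular, $$\bigl\|\partial_t^\rho\bigl(\mathcal M_{p,\alpha}-\mathcal M_{q,\beta}\bigr)\bigr\|_{L^\infty(0,T)}=\infty\quad\text{whenever }\alpha\ne\beta.$$
   Context: Let $T>0$ and let $X$ be a separable Hilbert space with inner product $(\cdot,\cdot)_X$ (linear in the first argument) and norm $\|\cdot\|_X$. For $\alpha\in(0,1)$ the fractional Riemann--Liouville integral (Bochner integral) is $J^\alpha w(t):=\frac1{\Gamma(\alpha)}\int_0^t(t-s)^{\alpha-1}w(s)\,ds$, $0<t<T$. It is an injective operator on $L^2(0,T;X)$, and likewise on scalar-valued $L^2(0,T)$. Set $\partial_t^\alpha:=(J^\alpha)^{-1}$ with domain $H_\alpha(0,T;X):=J^\alpha L^2(0,T;X)$. For scalar-valued functions write $H_\alpha(0,T):=J^\alpha L^2(0,T)$, with $\partial_t^\alpha=(J^\alpha)^{-1}$ on it. The statement $\partial_t^\rho w\in L^\infty(0,T)$ means that $w\in H_\rho(0,T)$ and $(J^\rho)^{-1}w\in L^\infty(0,T)$; otherwise $\|\partial_t^\rho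 w\|_{L^\infty(0,T)}$ is understood to be $\infty$. Operator: $A:\mathcal D(A)\subset X\to X$ is densely defined, self-adjoint and negative, $-A\ge\lambda_1I$ for some $\lambda_1>0$, and $A$ has compact resolvent. Thus $-A=\sum_{n=1}^\infty\lambda_nP_n$ with $0<\lambda_1<\lambda_2<\cdots$ the distinct eigenvalues and $P_n$ the mutually orthogonal spectral projections. For $a,b>0$, $E_{a,b}(z):=\sum_{k=0}^\infty \frac{z^k}{\Gamma(ak+b)}$ is the two-parameter Mittag--Leffler function. Fix constants $0<\alpha_-<\alpha_+<1$, $p_0\ne0$, $M>|p_0|$, and put $\mathcal A:=[\alpha_-,\alpha_+]$, $\mathcal P:=\{p\in C^1[0,T]: p(0)=p_0,\ \|p\|_{C^1[0,T]}\le M\}$ (scalar-valued functions). Fix $f\in X$ and $\psi\in\mathcal D(A)$ with $c_*:=p_0(f,\psi)_X\ne0$. For $p\in\mathcal P$, $\alpha\in\mathcal A$, $u_{p,\alpha}\in H_\alpha(0,T;X)$ denotes the solution of $\partial_t^\alpha u(t)=Au(t)+p(t)f$, $t\in(0,T)$, given by $$u_{p,\alpha}(t)=\sum_{n=1}^\infty\int_0^t(t-s)^{\alpha-1}E_{\alpha,\alpha}\bigl(-\lambda_n(t-s)^\alpha\bigr)p(s)P_nf\,ds,$$ with the series convergent in $H_\alpha(0,T;X)\cap L^2(0,T;\mathcal D(A))$. The scalar observation is $\mathcal M_{p,\alpha}(t):=(u_{p,\alpha}(t),\psi)_X$, $0<t<T$. *)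

theory Defs
  imports "HOL-Analysis.Analysis" "HOL-Probability.Essential_Supremum"
begin

text \<open>
  The scalar field is a type \<open>'k\<close> of sort \<open>{real_normed_field, euclidean_space}\<close>.  Up to isomorphism
  the only such fields are \<open>\<real>\<close> and \<open>\<complex>\<close>, so real and complex Hilbert spaces are both covered.
  On either field \<open>z \<bullet> 1\<close> is the real part of \<open>z\<close>, which yields the conjugation below.
\<close>

definition scalar_cnj :: "'k::{real_normed_field,euclidean_space} \<Rightarrow> 'k" where
  "scalar_cnj z = of_real (2 * (z \<bullet> 1)) - z"

lemma scalar_cnj_complex: "scalar_cnj (z::complex) = cnj z"
  by (simp add: scalar_cnj_def complex_eq_iff inner_complex_def)

lemma scalar_cnj_real: "scalar_cnj (x::real) = x"
  by (simp add: scalar_cnj_def)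

text \<open>
  Completeness and separability come from the sort of \<open>'x\<close>; the norm of \<open>'x\<close> is the one induced
  by \<open>ip\<close>, and \<open>smul\<close> extends the real scalar multiplication.
\<close>

locale hilbert_space = vector_space smul
  for smul :: "'k::{real_normed_field,euclidean_space} \<Rightarrow> 'x::{banach,second_countable_topology} \<Rightarrow> 'x" +
  fixes ip :: "'x \<Rightarrow> 'x \<Rightarrow> 'k"
  assumes scale_of_real: "smul (of_real r) x = r *\<^sub>R x"
    and ip_add_left: "ip (x + y) z = ip x z + ip y z"
    and ip_scale_left: "ip (smul a x) z = a * ip x z"
    and ip_commute: "ip y x = scalar_cnj (ip x y)"
    and ip_self: "ip x x = of_real ((norm x)\<^sup>2)"

lemma hilbert_space_real:
  "hilbert_space scaleR (inner :: 'x::{real_inner,banach,second_countable_topology} \<Rightarrow> 'x \<Rightarrow> real)"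
  by unfold_locales
    (auto simp: scalar_cnj_real inner_add_left inner_commute dot_square_norm algebra_simps)

lemma hilbert_space_complex:
  "hilbert_space (*) (\<lambda>x y. x * cnj y :: complex)"
  by unfold_locales
    (auto simp: scalar_cnj_complex algebra_simps scaleR_conv_of_real complex_norm_square[symmetric])

definition linear_operator_on :: "('k::field \<Rightarrow> 'x::ab_group_add \<Rightarrow> 'x) \<Rightarrow> 'x set \<Rightarrow> ('x \<Rightarrow> 'x) \<Rightarrow> bool" where
  "linear_operator_on smul D A \<longleftrightarrow>
     module.subspace smul D \<and>
     (\<forall>x\<in>D. \<forall>y\<in>D. A (x + y) = A x + A y) \<and>
     (\<forall>c. \<forall>x\<in>D. A (smul c x) = smul c (A x))"

definition adjoint_domain :: "('x \<Rightarrow> 'x \<Rightarrow> 'k) \<Rightarrow> 'x set \<Rightarrow> ('x \<Rightarrow> 'x) \<Rightarrow> 'x set" where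
  "adjoint_domain ip D A = {y. \<exists>z. \<forall>x\<in>D. ip (A x) y = ip x z}"

definition self_adjoint_operator :: "('x \<Rightarrow> 'x \<Rightarrow> 'k) \<Rightarrow> 'x set \<Rightarrow> ('x \<Rightarrow> 'x) \<Rightarrow> bool" where
  "self_adjoint_operator ip D A \<longleftrightarrow>
     adjoint_domain ip D A = D \<and> (\<forall>x\<in>D. \<forall>y\<in>D. ip (A x) y = ip x (A y))"

definition bounded_below_by ::
    "('x::real_normed_vector \<Rightarrow> 'x \<Rightarrow> 'k::{real_normed_field,euclidean_space}) \<Rightarrow> 'x set \<Rightarrow> ('x \<Rightarrow> 'x) \<Rightarrow> real \<Rightarrow> bool" where
  "bounded_below_by ip D B c \<longleftrightarrow> (\<forall>x\<in>D. ip (B x) x \<bullet> 1 \<ge> c * (norm x)\<^sup>2)"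

definition compact_resolvent ::
    "('k \<Rightarrow> 'x::real_normed_vector \<Rightarrow> 'x) \<Rightarrow> 'x set \<Rightarrow> ('x \<Rightarrow> 'x) \<Rightarrow> bool" where
  "compact_resolvent smul D A \<longleftrightarrow>
     (\<exists>\<mu>. bij_betw (\<lambda>x. smul \<mu> x - A x) D UNIV \<and>
        (\<forall>S. bounded S \<longrightarrow> compact (closure (inv_into D (\<lambda>x. smul \<mu> x - A x) ` S))))"

definition eigenspace :: "('k \<Rightarrow> 'x \<Rightarrow> 'x) \<Rightarrow> 'x set \<Rightarrow> ('x \<Rightarrow> 'x) \<Rightarrow> 'k \<Rightarrow> 'x set" where
  "eigenspace smul D B \<mu> = {x \<in> D. B x = smul \<mu> x}"

definition eigenvalues :: "('k \<Rightarrow> 'x::zero \<Rightarrow> 'x) \<Rightarrow> 'x set \<Rightarrow> ('x \<Rightarrow> 'x) \<Rightarrow> 'k set" where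
  "eigenvalues smul D B = {\<mu>. \<exists>x \<in> eigenspace smul D B \<mu>. x \<noteq> 0}"

definition is_orthogonal_projection ::
    "('x::ab_group_add \<Rightarrow> 'x \<Rightarrow> 'k::zero) \<Rightarrow> 'x set \<Rightarrow> ('x \<Rightarrow> 'x) \<Rightarrow> bool" where
  "is_orthogonal_projection ip S Q \<longleftrightarrow> (\<forall>x. Q x \<in> S \<and> (\<forall>y\<in>S. ip (x - Q x) y = 0))"

text \<open>
  \<open>B = \<Sum>\<^sub>n \<lambda>\<^sub>n P\<^sub>n\<close> with \<open>0 < \<lambda>\<^sub>1 < \<lambda>\<^sub>2 < \<dots>\<close> the distinct eigenvalues of \<open>B\<close> and \<open>P\<^sub>n\<close> the spectral
  projections; \<open>lam n\<close> and \<open>P n\<close> stand for \<open>\<lambda>\<^sub>n\<^sub>+\<^sub>1\<close> and \<open>P\<^sub>n\<^sub>+\<^sub>1\<close>.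
\<close>

definition spectral_decomposition ::
    "('k \<Rightarrow> 'x \<Rightarrow> 'x) \<Rightarrow> ('x::real_normed_vector \<Rightarrow> 'x \<Rightarrow> 'k::real_normed_field) \<Rightarrow>
     'x set \<Rightarrow> ('x \<Rightarrow> 'x) \<Rightarrow> (nat \<Rightarrow> real) \<Rightarrow> (nat \<Rightarrow> 'x \<Rightarrow> 'x) \<Rightarrow> bool" where
  "spectral_decomposition smul ip D B lam P \<longleftrightarrow>
     0 < lam 0 \<and> strict_mono lam \<and>
     eigenvalues smul D B = of_real ` range lam \<and>
     (\<forall>n. is_orthogonal_projection ip (eigenspace smul D B (of_real (lam n))) (P n)) \<and>
     (\<forall>x\<in>D. (\<lambda>n. lam n *\<^sub>R P n x) sums B x)"


definition rl_integral :: "real \<Rightarrow> (real \<Rightarrow> 'a::{banach,second_countable_topology}) \<Rightarrow> real \<Rightarrow> 'a" where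
  "rl_integral \<alpha> w t = (1 / Gamma \<alpha>) *\<^sub>R (LINT s:{0<..<t}|lebesgue. (t - s) powr (\<alpha> - 1) *\<^sub>R w s)"

text \<open>
  The Lebesgue spaces consist of functions rather than of classes; accordingly, membership in
  \<open>H_space\<close> is equality almost everywhere on \<open>(0,T)\<close>, and \<open>frac_deriv\<close> picks one representative of
  the class \<open>(J\<^sup>\<rho>)\<^sup>-\<^sup>1 w\<close>.
\<close>

definition L2_space :: "real \<Rightarrow> (real \<Rightarrow> 'a::{banach,second_countable_topology}) set" where
  "L2_space T = {g \<in> borel_measurable (lebesgue_on {0<..<T}).
     integrable (lebesgue_on {0<..<T}) (\<lambda>t. (norm (g t))\<^sup>2)}"

definition Linf_norm :: "real \<Rightarrow> (real \<Rightarrow> 'a::{banach,second_countable_topology}) \<Rightarrow> ereal" where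
  "Linf_norm T g = esssup (lebesgue_on {0<..<T}) (\<lambda>t. ereal (norm (g t)))"

definition Linf_space :: "real \<Rightarrow> (real \<Rightarrow> 'a::{banach,second_countable_topology}) set" where
  "Linf_space T = {g \<in> borel_measurable (lebesgue_on {0<..<T}). Linf_norm T g < \<infinity>}"

definition H_space :: "real \<Rightarrow> real \<Rightarrow> (real \<Rightarrow> 'a::{banach,second_countable_topology}) set" where
  "H_space \<rho> T = {w. \<exists>g \<in> L2_space T. AE t in lebesgue_on {0<..<T}. w t = rl_integral \<rho> g t}"

definition frac_deriv :: "real \<Rightarrow> real \<Rightarrow> (real \<Rightarrow> 'a::{banach,second_countable_topology}) \<Rightarrow> real \<Rightarrow> 'a" where
  "frac_deriv \<rho> T w =
     (SOME g. g \<in> L2_space T \<and> (AE t in lebesgue_on {0<..<T}. w t = rl_integral \<rho> g t))"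

definition frac_deriv_in_Linf :: "real \<Rightarrow> real \<Rightarrow> (real \<Rightarrow> 'a::{banach,second_countable_topology}) \<Rightarrow> bool" where
  "frac_deriv_in_Linf \<rho> T w \<longleftrightarrow> w \<in> H_space \<rho> T \<and> frac_deriv \<rho> T w \<in> Linf_space T"

definition frac_deriv_Linf_norm :: "real \<Rightarrow> real \<Rightarrow> (real \<Rightarrow> 'a::{banach,second_countable_topology}) \<Rightarrow> ereal" where
  "frac_deriv_Linf_norm \<rho> T w =
     (if frac_deriv_in_Linf \<rho> T w then Linf_norm T (frac_deriv \<rho> T w) else \<infinity>)"


definition mittag_leffler :: "real \<Rightarrow> real \<Rightarrow> 'a::{real_normed_field,banach} \<Rightarrow> 'a" where
  "mittag_leffler a b z = (\<Sum>k. z ^ k /\<^sub>R Gamma (a * real k + b))"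


definition C1_on :: "real \<Rightarrow> (real \<Rightarrow> 'a::real_normed_vector) \<Rightarrow> bool" where
  "C1_on T p \<longleftrightarrow> (\<forall>t\<in>{0..T}. p differentiable (at t within {0..T})) \<and>
     continuous_on {0..T} (\<lambda>t. vector_derivative p (at t within {0..T}))"

definition C1_norm :: "real \<Rightarrow> (real \<Rightarrow> 'a::real_normed_vector) \<Rightarrow> real" where
  "C1_norm T p = (SUP t\<in>{0..T}. norm (p t)) +
     (SUP t\<in>{0..T}. norm (vector_derivative p (at t within {0..T})))"

definition admissible_sources :: "real \<Rightarrow> 'a \<Rightarrow> real \<Rightarrow> (real \<Rightarrow> 'a::real_normed_vector) set" where
  "admissible_sources T p0 M = {p. C1_on T p \<and> p 0 = p0 \<and> C1_norm T p \<le> M}"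

text \<open>
  The series converges in \<open>X\<close> at every \<open>t\<close>, because its terms are mutually orthogonal and its scalar
  coefficients are bounded in \<open>n\<close>.  Its pointwise sum is a representative of its limit in
  \<open>H\<^sub>\<alpha>(0,T;X) \<inter> L\<^sup>2(0,T;D(A))\<close>.
\<close>

definition solution ::
    "('k \<Rightarrow> 'x \<Rightarrow> 'x) \<Rightarrow> (nat \<Rightarrow> real) \<Rightarrow> (nat \<Rightarrow> 'x \<Rightarrow> 'x) \<Rightarrow> 'x \<Rightarrow>
     (real \<Rightarrow> 'k::{banach,second_countable_topology}) \<Rightarrow> real \<Rightarrow> real \<Rightarrow> 'x::banach" where
  "solution smul lam P f p \<alpha> t =
     (\<Sum>n. smul
        (LINT s:{0<..<t}|lebesgue.
           ((t - s) powr (\<alpha> - 1) * mittag_leffler \<alpha> \<alpha> (- lam n * (t - s) powr \<alpha>)) *\<^sub>R p s)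
        (P n f))"

definition observation ::
    "('k \<Rightarrow> 'x \<Rightarrow> 'x) \<Rightarrow> ('x \<Rightarrow> 'x \<Rightarrow> 'k) \<Rightarrow> (nat \<Rightarrow> real) \<Rightarrow> (nat \<Rightarrow> 'x \<Rightarrow> 'x) \<Rightarrow> 'x::banach \<Rightarrow> 'x \<Rightarrow>
     (real \<Rightarrow> 'k::{banach,second_countable_topology}) \<Rightarrow> real \<Rightarrow> real \<Rightarrow> 'k" where
  "observation smul ip lam P f \<psi> p \<alpha> t = ip (solution smul lam P f p \<alpha> t) \<psi>"

end

theory Submission
  imports Defs "HOL-Complex_Analysis.Conformal_Mappings" "HOL-Real_Asymp.Real_Asymp"
begin

text \<open>
  The order of the equation can be read off from the behaviour of the observation as \<open>t \<rightarrow> 0\<close>: it is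
  \<open>p(0) (f, \<psi>) t powr \<alpha> / Gamma(\<alpha> + 1)\<close> to leading order (lemma \<open>observation_asymptotics\<close>; there the
  constant appears as \<open>1 / (\<alpha> Gamma \<alpha>)\<close>).  If, say, \<open>\<alpha> < \<beta>\<close>, then the difference \<open>w\<close> of the two
  observations has exact order \<open>t powr \<alpha>\<close>, as \<open>p(0) (f, \<psi>)\<close> is nonzero and the second observation is
  of smaller order.  On the other hand, \<open>w = J\<^sup>\<rho> g\<close> with a bounded \<open>g\<close> implies
  \<open>|w t| \<le> C t powr \<rho>\<close> almost everywhere (lemma \<open>rl_integral_Linf_bound\<close>).  As \<open>\<rho>\<close> exceeds both
  orders, the two are incompatible (lemma \<open>no_AE_bound_of_smaller_order\<close>).

  The substance lies in the asymptotics.  The coefficient of \<open>P n f\<close> in the solution is the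
  convolution of \<open>p\<close> with \<open>t powr (\<alpha> - 1) E\<^bsub>\<alpha>,\<alpha>\<^esub>(-\<lambda>\<^sub>n t powr \<alpha>)\<close>.  Its behaviour for one \<open>n\<close> is plain, but
  summing over \<open>n\<close> requires a bound on \<open>E\<^bsub>\<alpha>,\<alpha>\<^esub>(-x)\<close> that is uniform in \<open>x \<ge> 0\<close>.  The bound
  \<open>0 \<le> E\<^bsub>\<alpha>,\<alpha>\<^esub>(-x) \<le> 1 / Gamma \<alpha>\<close> (lemma \<open>mittag_leffler_bounds\<close>) has an elementary
  reason: the function \<open>t powr (\<alpha> - 1) E\<^bsub>\<alpha>,\<alpha>\<^esub>(-t powr \<alpha>)\<close> solves a Volterra
  equation whose kernel \<open>t powr (\<alpha> - 1)\<close> is such that no first change of sign can occur.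

  The sum over \<open>n\<close> is then controlled by Bessel's inequality and evaluated with
  \<open>\<Sum>\<^sub>n P n \<psi> = \<psi>\<close> for \<open>\<psi>\<close> in the domain of \<open>A\<close> (lemma \<open>spectral_projections_sums\<close>).
\<close>

section \<open>The Mittag-Leffler function on the negative axis\<close>

lemma pos_not_nonpos_Int: "(x::real) > 0 \<Longrightarrow> x \<notin> \<int>\<^sub>\<le>\<^sub>0"
  by (auto elim!: nonpos_Ints_cases)

text \<open>
  The logarithm of \<open>Gamma\<close> is convex, and its increment over \<open>[y - 1, y]\<close> is \<open>ln (y - 1)\<close>; hence
  its average slope over \<open>[y, y + a]\<close> is at least that.  This growth is what makes the
  Mittag-Leffler series converge everywhere.
\<close>

lemma Gamma_add_ge:
  fixes y a :: real
  assumes "y > 1" "a > 0"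
  shows "(y - 1) powr a * Gamma y \<le> Gamma (y + a)"
proof -
  define g where "g = (\<lambda>x. ln (Gamma x) :: real)"
  have conv: "convex_on {0<..} g"
    using log_convex_Gamma_real by (simp add: g_def o_def)
  have comb: "(a / (1 + a)) * (y - 1) + (1 / (1 + a)) * (y + a) = y"
  proof -
    have "(a * (y - 1) + (y + a)) / (1 + a) = y"
      using assms by (subst divide_eq_eq) (auto simp: algebra_simps)
    thus ?thesis by (simp add: add_divide_distrib)
  qed
  have c: "1 - 1 / (1 + a) = a / (1 + a)"
    using assms by (simp add: field_simps)
  have "g ((a / (1 + a)) *\<^sub>R (y - 1) + (1 / (1 + a)) *\<^sub>R (y + a))
        \<le> (a / (1 + a)) * g (y - 1) + (1 / (1 + a)) * g (y + a)"
    using convex_onD[OF conv, of "1 / (1 + a)" "y - 1" "y + a", unfolded c] assms by simp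
  hence "g y \<le> (a / (1 + a)) * g (y - 1) + (1 / (1 + a)) * g (y + a)"
    by (simp only: comb real_scaleR_def)
  hence "(1 + a) * g y \<le> a * g (y - 1) + g (y + a)"
  proof -
    have "(a / (1 + a)) * g (y - 1) + (1 / (1 + a)) * g (y + a) = (a * g (y - 1) + g (y + a)) / (1 + a)"
      by (simp add: add_divide_distrib)
    with \<open>g y \<le> _\<close> assms show ?thesis by (simp add: pos_le_divide_eq mult.commute)
  qed
  moreover have "Gamma y = (y - 1) * Gamma (y - 1)"
    using Gamma_plus1[OF pos_not_nonpos_Int, of "y - 1"] assms by simp
  hence "g y = ln (y - 1) + g (y - 1)"
    unfolding g_def using assms Gamma_real_pos[of "y - 1"] by (simp only: ln_mult_pos diff_gt_0_iff_gt)
  ultimately have "a * ln (y - 1) + g y \<le> g (y + a)"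
    by (simp add: algebra_simps)
  hence "exp (a * ln (y - 1) + g y) \<le> exp (g (y + a))"
    by simp
  thus ?thesis
    using assms by (simp add: exp_add g_def powr_def mult.commute)
qed

lemma summable_mittag_leffler_real:
  fixes x a b :: real
  assumes "a > 0" "b > 0"
  shows "summable (\<lambda>k. x ^ k / Gamma (a * real k + b))"
proof -
  \<comment> \<open>the threshold for the Gamma argument beyond which consecutive terms at least halve\<close>
  define C where "C = (2 * \<bar>x\<bar> + 1) powr (1 / a) + 1"
  have "1 < C" using assms by (simp add: C_def)
  obtain N where N: "real N > C / a" using reals_Archimedean2 by blast
  show ?thesis
  proof (rule summable_ratio_test[where c = "1/2" and N = N])
    fix n assume "N \<le> n"
    define y where "y = a * real n + b"
    have "C < a * real n"
    proof -
      have "C / a < real n" using N \<open>N \<le> n\<close> by linarith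
      thus ?thesis using assms by (simp add: field_simps)
    qed
    hence y: "C < y" "1 < y" using assms \<open>1 < C\<close> by (auto simp: y_def)
    have "2 * \<bar>x\<bar> + 1 = ((2 * \<bar>x\<bar> + 1) powr (1 / a)) powr a"
      using assms by (simp add: powr_powr)
    also have "\<dots> \<le> (y - 1) powr a"
      using y assms by (intro powr_mono2) (auto simp: C_def)
    finally have "(2 * \<bar>x\<bar> + 1) * Gamma y \<le> (y - 1) powr a * Gamma y"
      using y by (intro mult_right_mono) (auto intro: less_imp_le)
    also have "\<dots> \<le> Gamma (y + a)"
      using Gamma_add_ge[of y a] y assms by simp
    finally have le: "(2 * \<bar>x\<bar> + 1) * Gamma y \<le> Gamma (y + a)" .
    have G: "2 * \<bar>x\<bar> * Gamma y \<le> Gamma (y + a)"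
    proof -
      have "Gamma y > 0" using y by simp
      moreover have "(2 * \<bar>x\<bar> + 1) * Gamma y = 2 * \<bar>x\<bar> * Gamma y + Gamma y" by (simp add: algebra_simps)
      ultimately show ?thesis using le by linarith
    qed
    have yS: "a * real (Suc n) + b = y + a" by (simp add: y_def algebra_simps)
    have pos: "Gamma y > 0" "Gamma (y + a) > 0" using y assms by auto
    have "\<bar>x\<bar> / Gamma (y + a) \<le> 1 / (2 * Gamma y)"
      using G pos by (simp add: field_simps)
    hence "\<bar>x\<bar> ^ n * (\<bar>x\<bar> / Gamma (y + a)) \<le> \<bar>x\<bar> ^ n * (1 / (2 * Gamma y))"
      by (intro mult_left_mono) auto
    thus "norm (x ^ Suc n / Gamma (a * real (Suc n) + b)) \<le> 1/2 * norm (x ^ n / Gamma (a * real n + b))"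
      unfolding yS unfolding y_def[symmetric] using pos by (simp add: abs_mult power_abs mult_ac)
  qed simp
qed

lemma summable_mittag_leffler:
  fixes z :: "'a::{real_normed_field,banach}"
  assumes "a > 0" "b > 0"
  shows "summable (\<lambda>k. norm (z ^ k /\<^sub>R Gamma (a * real k + b)))"
proof -
  have "Gamma (a * real k + b) > 0" for k
    using assms by (intro Gamma_real_pos add_nonneg_pos) auto
  thus ?thesis
    using summable_mittag_leffler_real[OF assms, of "norm z"]
    by (simp add: norm_power divide_inverse mult.commute abs_of_pos)
qed

lemma mittag_leffler_powser:
  "mittag_leffler a b z = (\<Sum>k. inverse (of_real (Gamma (a * real k + b))) * z ^ k)"
  by (simp add: mittag_leffler_def scaleR_conv_of_real of_real_inverse)

lemma isCont_mittag_leffler: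
  fixes z :: "'a::{real_normed_field,banach}"
  assumes "a > 0" "b > 0"
  shows "isCont (mittag_leffler a b) z"
proof -
  have "summable (\<lambda>k. inverse (of_real (Gamma (a * real k + b))) * y ^ k)" for y :: 'a
    using summable_norm_cancel[OF summable_mittag_leffler[OF assms, of y]]
    by (simp add: scaleR_conv_of_real of_real_inverse)
  from isCont_powser_converges_everywhere[OF this] show ?thesis
    unfolding mittag_leffler_powser[abs_def] by simp
qed

lemma continuous_on_mittag_leffler_powr:
  fixes a b l :: real
  assumes "a > 0" "b > 0"
  shows "continuous_on {0..} (\<lambda>s. mittag_leffler a b (- l * s powr a))"
proof (rule continuous_on_compose2[where g = "mittag_leffler a b" and t = UNIV and f = "\<lambda>s. - l * s powr a"])
  show "continuous_on UNIV (mittag_leffler a b :: real \<Rightarrow> real)"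
    using isCont_mittag_leffler assms by (auto intro!: continuous_at_imp_continuous_on)
  show "continuous_on {0..} (\<lambda>s. - l * s powr a)"
    using assms by (intro continuous_on_mult continuous_on_powr' continuous_on_id continuous_on_const) auto
qed auto

lemma mittag_leffler_0: "mittag_leffler a b (0::'a::{real_normed_field,banach}) = of_real (1 / Gamma b)"
proof -
  have "mittag_leffler a b (0::'a) = (\<Sum>k\<in>{0}. 0 ^ k /\<^sub>R Gamma (a * real k + b))"
    unfolding mittag_leffler_def by (intro suminf_finite) auto
  thus ?thesis by (simp add: scaleR_conv_of_real divide_inverse)
qed

lemma mittag_leffler_of_real:
  assumes "a > 0" "b > 0"
  shows "mittag_leffler a b (complex_of_real x) = complex_of_real (mittag_leffler a b x)"
proof -
  have "summable (\<lambda>k. x ^ k /\<^sub>R Gamma (a * real k + b))"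
    using summable_norm_cancel[OF summable_mittag_leffler[OF assms]] .
  from suminf_of_real[OF this, where 'a = complex] show ?thesis
    unfolding mittag_leffler_def by (simp add: scaleR_conv_of_real)
qed

lemma holomorphic_mittag_leffler:
  assumes "a > 0" "b > 0"
  shows "mittag_leffler a b holomorphic_on (UNIV :: complex set)"
proof -
  have "mittag_leffler a b holomorphic_on ball 0 r" for r
  proof (rule power_series_holomorphic[where a = "\<lambda>k. inverse (of_real (Gamma (a * real k + b)))"])
    fix z :: complex assume "z \<in> ball 0 r"
    have "summable (\<lambda>k. z ^ k /\<^sub>R Gamma (a * real k + b))"
      using summable_norm_cancel[OF summable_mittag_leffler[OF assms]] .
    thus "(\<lambda>k. inverse (of_real (Gamma (a * real k + b))) * (z - 0) ^ k) sums mittag_leffler a b z"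
      unfolding mittag_leffler_def by (simp add: scaleR_conv_of_real of_real_inverse summable_sums)
  qed
  hence "mittag_leffler a b field_differentiable (at z)" for z :: complex
    using holomorphic_on_imp_differentiable_at[of _ "ball 0 (norm z + 1)" z] by auto
  thus ?thesis by (auto simp: holomorphic_on_def field_differentiable_at_within)
qed

text \<open>
  The zeros on the real line are zeros of an entire function that does not vanish at \<open>0\<close>.
\<close>

lemma mittag_leffler_zeros_isolated:
  fixes x :: real
  assumes "a > 0" "b > 0" "mittag_leffler a b x = 0"
  obtains r where "r > 0" "\<And>y. y \<noteq> x \<Longrightarrow> \<bar>y - x\<bar> < r \<Longrightarrow> mittag_leffler a b y \<noteq> 0"
proof -
  have ne: "mittag_leffler a b (0::complex) \<noteq> 0"
    using Gamma_real_pos[OF assms(2)] by (auto simp: mittag_leffler_0)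
  obtain r where r: "r > 0"
    "\<And>z::complex. z \<in> ball (of_real x) r - {of_real x} \<Longrightarrow> mittag_leffler a b z \<noteq> 0"
    using isolated_zeros[OF holomorphic_mittag_leffler[OF assms(1,2)], of "of_real x" 0] ne assms
    by (metis UNIV_I connected_UNIV mittag_leffler_of_real of_real_0 open_UNIV)
  show ?thesis
  proof
    show "r > 0" by fact
    fix y :: real assume "y \<noteq> x" "\<bar>y - x\<bar> < r"
    hence "complex_of_real y \<in> ball (of_real x) r - {of_real x}"
      by (auto simp: dist_norm simp flip: of_real_diff)
    from r(2)[OF this] show "mittag_leffler a b y \<noteq> 0"
      using assms by (simp add: mittag_leffler_of_real)
  qed
qed

lemma has_integral_Beta_scaled:
  fixes a b t :: real
  assumes "a > 0" "b > 0" "t > 0"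
  shows "((\<lambda>s. (t - s) powr (b - 1) * s powr (a - 1)) has_integral t powr (a + b - 1) * Beta a b) {0..t}"
proof -
  have "((\<lambda>s. ((1/t) *\<^sub>R s + 0) powr (a - 1) * (1 - ((1/t) *\<^sub>R s + 0)) powr (b - 1))
      has_integral (\<bar>1/t\<bar> ^ DIM(real)) *\<^sub>R 0 + (1 / \<bar>1/t\<bar> ^ DIM(real)) *\<^sub>R Beta a b)
      ((\<lambda>s. (1 / (1/t)) *\<^sub>R s + - ((1 / (1/t)) *\<^sub>R 0)) ` cbox 0 1)"
    using has_integral_affinity[of "\<lambda>t. t powr (a - 1) * (1 - t) powr (b - 1)" "Beta a b" 0 1 "1/t" 0]
      has_integral_Beta_real[OF assms(1,2)] assms by simp
  moreover have "(\<lambda>s. t * s) ` {0..1} = {0..t}"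
    using assms image_mult_atLeastAtMost[of t 0 1] by (simp add: mult.commute)
  ultimately have "((\<lambda>s. (s/t) powr (a - 1) * (1 - s/t) powr (b - 1)) has_integral t * Beta a b) {0..t}"
    using assms by simp
  note scaled = has_integral_mult_right[OF this, of "t powr (a + b - 2)"]
  have "((\<lambda>s. t powr (a + b - 2) * ((s/t) powr (a - 1) * (1 - s/t) powr (b - 1)))
      has_integral t powr (a + b - 1) * Beta a b) {0..t}"
  proof -
    have "t powr (a + b - 2) * (t * Beta a b) = t powr (a + b - 1) * Beta a b"
      using assms powr_mult_base[of t "a + b - 2"] by (simp add: mult_ac)
    thus ?thesis using scaled by (simp only:)
  qed
  thus ?thesis
  proof (rule has_integral_eq[rotated])
    fix s assume s: "s \<in> {0..t}"
    have "1 - s/t = (t - s)/t" using assms by (simp add: field_simps)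
    hence "(s/t) powr (a - 1) * (1 - s/t) powr (b - 1)
        = s powr (a - 1) * (t - s) powr (b - 1) / (t powr (a - 1) * t powr (b - 1))"
      using s assms by (simp add: powr_divide)
    moreover have "t powr (a - 1) * t powr (b - 1) = t powr (a + b - 2)"
      by (simp flip: powr_add)
    ultimately show "t powr (a + b - 2) * ((s/t) powr (a - 1) * (1 - s/t) powr (b - 1))
        = (t - s) powr (b - 1) * s powr (a - 1)"
      using assms by simp
  qed
qed

text \<open>
  With \<open>k(t) = t powr (a - 1)\<close> and \<open>r(t) = k(t) E\<^bsub>a,a\<^esub>(-t powr a)\<close> this is the resolvent equation
  \<open>k * r = k - Gamma a \<cdot> r\<close> of the Riemann--Liouville kernel, with \<open>*\<close> for convolution.  It holds term
  by term: by the Beta integral, convolution with \<open>k / Gamma a\<close> maps each term of the series of \<open>r\<close> to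
  minus the next one.
\<close>

lemma mittag_leffler_renewal:
  fixes a t :: real
  assumes a: "a > 0" and t: "t > 0"
  shows "((\<lambda>s. (t - s) powr (a - 1) * (s powr (a - 1) * mittag_leffler a a (- (s powr a))))
      has_integral t powr (a - 1) * (1 - Gamma a * mittag_leffler a a (- (t powr a)))) {0..t}"
proof -
  define F where "F = (\<lambda>s. (t - s) powr (a - 1) * (s powr (a - 1) * mittag_leffler a a (- (s powr a))))"
  \<comment> \<open>f j is the j-th term of the integrand F, and I j is the integral of its absolute value\<close>
  define h where "h = (\<lambda>(j::nat) s. (t - s) powr (a - 1) * s powr (a * real j + a - 1))"
  define G where "G = (\<lambda>j::nat. Gamma (a * real j + a))"
  define f where "f = (\<lambda>j s. (-1) ^ j / G j * h j s)"
  define I where "I = (\<lambda>j::nat. t powr (a * real j + 2 * a - 1) * (Gamma a / Gamma (a * real j + 2 * a)))"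
  let ?M = "lebesgue_on {0..t}"
  have Gpos: "G j > 0" for j
    unfolding G_def using a by (intro Gamma_real_pos add_nonneg_pos) auto
  have hI: "(h j has_integral I j * G j) {0..t}" for j
  proof -
    have "(h j has_integral t powr (a * real j + a + a - 1) * Beta (a * real j + a) a) {0..t}"
      unfolding h_def using has_integral_Beta_scaled[of "a * real j + a" a t] a t
      by (simp add: add_nonneg_pos)
    thus ?thesis
      by (simp add: I_def G_def Beta_def algebra_simps)
  qed
  have hnn: "h j s \<ge> 0" for j s by (simp add: h_def)
  have hai: "h j absolutely_integrable_on {0..t}" for j
    using hI hnn by (intro nonnegative_absolutely_integrable_1) (auto simp: integrable_on_def)
  hence hint: "integrable ?M (h j)" for j
    by (simp add: set_integrable_def integrable_restrict_space)
  have fint: "integrable ?M (f j)" for j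
    unfolding f_def by (intro integrable_mult_right hint)
  have hLI: "integral\<^sup>L ?M (h j) = I j * G j" for j
    using hI[of j] set_lebesgue_integral_eq_integral(2)[OF hai[of j]]
    by (simp add: set_lebesgue_integral_def integral_restrict_space integral_unique)
  have terms: "f j s = (t - s) powr (a - 1) * (s powr (a - 1) * ((- (s powr a)) ^ j /\<^sub>R G j))"
    if "s \<ge> 0" for j s
  proof -
    have "s powr (a * real j + a - 1) = s powr (a - 1) * (s powr a) ^ j"
    proof (cases "s = 0")
      case False
      with that have "(s powr a) ^ j = s powr (a * real j)"
        by (simp add: powr_powr flip: powr_realpow)
      thus ?thesis by (simp flip: powr_add add: algebra_simps)
    qed auto
    thus ?thesis
      by (simp add: f_def h_def power_minus[of "s powr a"] field_simps)
  qed
  have fsum: "(\<lambda>j. f j s) sums F s" "summable (\<lambda>j. norm (f j s))" if "s \<ge> 0" for s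
  proof -
    have s: "summable (\<lambda>j. norm ((- (s powr a)) ^ j /\<^sub>R G j))"
      unfolding G_def by (rule summable_mittag_leffler[OF a a])
    have "(\<lambda>j. (- (s powr a)) ^ j /\<^sub>R G j) sums mittag_leffler a a (- (s powr a))"
      using summable_norm_cancel[OF s] unfolding mittag_leffler_def G_def by (rule summable_sums)
    thus "(\<lambda>j. f j s) sums F s"
      unfolding F_def terms[OF that] by (intro sums_mult)
    show "summable (\<lambda>j. norm (f j s))"
      unfolding terms[OF that] norm_mult using s by (intro summable_mult)
  qed
  have fLI: "integral\<^sup>L ?M (f j) = (-1) ^ j * I j" for j
    using Gpos[of j] by (simp add: f_def hLI)
  have fnI: "integral\<^sup>L ?M (\<lambda>s. norm (f j s)) = I j" for j
  proof -
    have "norm (f j s) = 1 / G j * h j s" for s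
      using Gpos[of j] hnn[of j s] by (simp add: f_def abs_mult)
    thus ?thesis using Gpos[of j] by (simp add: hLI)
  qed
  have Ieq: "I j = (t powr a) ^ Suc j / G (Suc j) * (Gamma a * t powr (a - 1))" for j
  proof -
    have "t powr (a * real j + 2 * a - 1) = t powr (a - 1) * (t powr a) ^ Suc j"
    proof -
      have "(t powr a) ^ Suc j = t powr (a * real (Suc j))"
        using t by (simp add: powr_powr flip: powr_realpow del: power_Suc)
      hence "t powr (a - 1) * (t powr a) ^ Suc j = t powr (a - 1 + a * real (Suc j))"
        by (simp only: powr_add)
      also have "a - 1 + a * real (Suc j) = a * real j + 2 * a - 1"
        by (simp add: algebra_simps)
      finally show ?thesis ..
    qed
    moreover have "a * real j + 2 * a = a * real (Suc j) + a" by (simp add: algebra_simps)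
    ultimately show ?thesis by (simp only: I_def G_def) simp
  qed
  have Isum: "summable I"
    unfolding Ieq
    using summable_mittag_leffler_real[OF a a, of "t powr a"]
    by (intro summable_mult2, subst summable_Suc_iff[where f = "\<lambda>j. (t powr a) ^ j / G j"]) (simp add: G_def)
  have ae: "AE s in ?M. summable (\<lambda>j. norm (f j s))"
    using fsum(2) by (intro AE_I2) auto
  have sumM: "summable (\<lambda>j. integral\<^sup>L ?M (\<lambda>s. norm (f j s)))"
    unfolding fnI by (rule Isum)
  have eqF: "(\<Sum>j. f j s) = F s" if "s \<in> space ?M" for s
    using fsum(1)[of s] that by (auto simp: sums_iff)
  have int: "integrable ?M F"
    using integrable_suminf[OF fint ae sumM] eqF
    by (subst Bochner_Integration.integrable_cong[OF refl, where g = "\<lambda>s. \<Sum>j. f j s"]) auto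
  have "(\<lambda>j. (-1) ^ j * I j) sums (\<integral>s. (\<Sum>j. f j s) \<partial>?M)"
    using sums_integral[OF fint ae sumM] by (simp add: fLI)
  also have "(\<integral>s. (\<Sum>j. f j s) \<partial>?M) = integral\<^sup>L ?M F"
    by (intro Bochner_Integration.integral_cong eqF refl)
  finally have S1: "(\<lambda>j. (-1) ^ j * I j) sums integral\<^sup>L ?M F" .
  have "(\<lambda>j. (- (t powr a)) ^ j /\<^sub>R G j) sums mittag_leffler a a (- (t powr a))"
    using summable_norm_cancel[OF summable_mittag_leffler[OF a a, of "- (t powr a)"]]
    unfolding mittag_leffler_def G_def by (rule summable_sums)
  hence "(\<lambda>j. (- (t powr a)) ^ Suc j /\<^sub>R G (Suc j)) sums (mittag_leffler a a (- (t powr a)) - 1 / Gamma a)"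
    by (subst sums_Suc_iff) (simp add: G_def divide_inverse)
  hence "(\<lambda>j. (- (Gamma a * t powr (a - 1))) * ((- (t powr a)) ^ Suc j /\<^sub>R G (Suc j)))
     sums ((- (Gamma a * t powr (a - 1))) * (mittag_leffler a a (- (t powr a)) - 1 / Gamma a))"
    by (rule sums_mult)
  moreover have "(- (Gamma a * t powr (a - 1))) * ((- (t powr a)) ^ Suc j /\<^sub>R G (Suc j)) = (-1) ^ j * I j" for j
    unfolding Ieq power_minus[of "t powr a"] by (simp add: field_simps)
  ultimately have "integral\<^sup>L ?M F = - (Gamma a * t powr (a - 1)) * (mittag_leffler a a (- (t powr a)) - 1 / Gamma a)"
    using S1 sums_unique2 by simp
  also have "\<dots> = t powr (a - 1) * (1 - Gamma a * mittag_leffler a a (- (t powr a)))"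
    using Gamma_real_pos[OF a] by (simp add: field_simps)
  finally have val: "integral\<^sup>L ?M F = t powr (a - 1) * (1 - Gamma a * mittag_leffler a a (- (t powr a)))" .
  have "F absolutely_integrable_on {0..t}"
    using int by (simp add: set_integrable_def integrable_restrict_space)
  from has_integral_set_lebesgue[OF this]
  show ?thesis
    unfolding F_def[symmetric] using val by (simp add: set_lebesgue_integral_def integral_restrict_space)
qed

text \<open>
  Here \<open>e\<close> is the Mittag-Leffler factor alone, so that \<open>k e\<close>, with \<open>k(t) = t powr (a - 1)\<close>, satisfies the
  preceding resolvent equation.  Suppose that \<open>e\<close> takes negative values, and let \<open>t\<^sub>0\<close> be the infimum of the points where it does.
  Then \<open>e t\<^sub>0 = 0\<close>, and since the zeros are isolated, \<open>e < 0\<close> on some \<open>(t\<^sub>0, t\<^sub>1]\<close>.  In the resolvent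
  equation at \<open>t\<^sub>1\<close> the part of the convolution over \<open>[t\<^sub>0, t\<^sub>1]\<close> is at most \<open>0\<close>.  On \<open>[0, t\<^sub>0]\<close>,
  where \<open>e \<ge> 0\<close>, the inequality \<open>k(t\<^sub>1 - s) k(t\<^sub>0) \<le> k(t\<^sub>1) k(t\<^sub>0 - s)\<close> and the resolvent equation at
  \<open>t\<^sub>0\<close> bound the remaining part by \<open>k(t\<^sub>1)\<close>.  The equation at \<open>t\<^sub>1\<close> then gives \<open>e t\<^sub>1 \<ge> 0\<close>,
  a contradiction.
\<close>

lemma mittag_leffler_nonneg:
  fixes a :: real
  assumes a: "0 < a" "a \<le> 1"
  defines "e \<equiv> \<lambda>s. mittag_leffler a a (- (s powr a))"
  assumes "s \<ge> 0"
  shows "e s \<ge> 0"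
proof (rule ccontr)
  assume "\<not> e s \<ge> 0"
  have cont: "continuous_on {0..} e"
    using continuous_on_mittag_leffler_powr[of a a 1] a by (simp add: e_def)
  have e0: "e 0 > 0"
  proof -
    have "e 0 = 1 / Gamma a"
      using mittag_leffler_0[of a a, where 'a = real] by (simp add: e_def)
    thus ?thesis using Gamma_real_pos[OF a(1)] by (simp del: Gamma_real_pos)
  qed
  define N where "N = {s. s \<ge> 0 \<and> e s < 0}"
  have sN: "s \<in> N" using \<open>\<not> e s \<ge> 0\<close> \<open>s \<ge> 0\<close> by (simp add: N_def)
  define t0 where "t0 = Inf N"
  have bdd: "bdd_below N" by (rule bdd_belowI[of _ 0]) (simp add: N_def)
  have t0: "t0 \<ge> 0" unfolding t0_def using sN by (intro cInf_greatest) (auto simp: N_def)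
  have below: "e r \<ge> 0" if "0 \<le> r" "r < t0" for r
    using that cInf_lower[OF _ bdd, of r] by (force simp: N_def t0_def)
  have near: "\<exists>r\<in>N. r < t0 + d" if "d > 0" for d
    using that cInf_less_iff[OF _ bdd, of "t0 + d"] sN by (auto simp: t0_def)
  have et0_le: "e t0 \<le> 0"
  proof (rule ccontr)
    assume "\<not> e t0 \<le> 0"
    then obtain d where d: "d > 0" "\<And>r. r \<ge> 0 \<Longrightarrow> dist r t0 < d \<Longrightarrow> dist (e r) (e t0) < e t0"
      using cont t0 unfolding continuous_on_iff by (metis atLeast_iff not_le)
    obtain r where r: "r \<in> N" "r < t0 + d" using near[OF d(1)] by blast
    hence "r \<ge> t0" using cInf_lower[OF _ bdd] by (auto simp: t0_def)
    thus False using d(2)[of r] r t0 by (auto simp: N_def dist_real_def)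
  qed
  have t0pos: "t0 > 0" using et0_le e0 t0 by (cases "t0 = 0") auto
  have et0: "e t0 = 0"
  proof (rule ccontr)
    assume "e t0 \<noteq> 0"
    hence "e t0 < 0" using et0_le by simp
    then obtain d where d: "d > 0" "\<And>r. r \<ge> 0 \<Longrightarrow> dist r t0 < d \<Longrightarrow> dist (e r) (e t0) < - e t0"
      using cont t0 unfolding continuous_on_iff by (metis atLeast_iff neg_0_less_iff_less)
    define r where "r = max (t0 / 2) (t0 - d / 2)"
    have "e r \<ge> 0" using below[of r] t0pos d(1) by (auto simp: r_def)
    thus False using d(2)[of r] t0pos d(1) by (auto simp: r_def dist_real_def max_def split: if_splits)
  qed
  obtain d where d: "d > 0" "\<And>r. t0 < r \<Longrightarrow> r < t0 + d \<Longrightarrow> e r \<noteq> 0"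
  proof -
    obtain \<eta> where \<eta>: "\<eta> > 0" "\<And>y. y \<noteq> - (t0 powr a) \<Longrightarrow> \<bar>y - - (t0 powr a)\<bar> < \<eta> \<Longrightarrow> mittag_leffler a a y \<noteq> 0"
      using mittag_leffler_zeros_isolated[of a a "- (t0 powr a)"] et0 a by (auto simp: e_def)
    have "continuous (at t0) (\<lambda>s. s powr a)" using t0pos by (intro continuous_intros) auto
    then obtain d where d: "d > 0" "\<And>r. dist r t0 < d \<Longrightarrow> dist (r powr a) (t0 powr a) < \<eta>"
      using \<eta>(1) unfolding continuous_at_eps_delta by (auto simp: dist_real_def)
    show ?thesis
    proof
      show "d > 0" by fact
      fix r assume r: "t0 < r" "r < t0 + d"
      have "t0 powr a < r powr a" using r t0pos a by (intro powr_less_mono2) auto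
      thus "e r \<noteq> 0"
        unfolding e_def using d(2)[of r] r by (intro \<eta>(2)) (auto simp: dist_real_def)
    qed
  qed
  obtain t1 where t1: "t1 \<in> N" "t1 < t0 + d" using near[OF d(1)] by blast
  have t01: "t0 < t1"
  proof -
    have "t0 \<le> t1" unfolding t0_def by (rule cInf_lower[OF t1(1) bdd])
    moreover have "t0 \<noteq> t1" using et0 t1(1) by (auto simp: N_def)
    ultimately show ?thesis by simp
  qed
  have neg: "e r \<le> 0" if r: "t0 \<le> r" "r \<le> t1" for r
  proof (rule ccontr)
    assume "\<not> e r \<le> 0"
    moreover have "continuous_on {r..t1} e"
      using cont that t0 by (rule_tac continuous_on_subset) auto
    ultimately obtain x where "r \<le> x" "x \<le> t1" "e x = 0"
      using IVT2'[of e t1 0 r] r t1(1) by (auto simp: N_def)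
    thus False using d(2)[of x] r t01 t1 et0 \<open>\<not> e r \<le> 0\<close>
      by (cases "x = t0") (auto simp: N_def)
  qed
  define k where "k = (\<lambda>s::real. s powr (a - 1))"
  have kpos: "k s > 0" if "s > 0" for s using that by (simp add: k_def)
  have knn: "k s \<ge> 0" for s by (simp add: k_def)
  have R0: "((\<lambda>s. k (t0 - s) * (k s * e s)) has_integral k t0) {0..t0}"
    using mittag_leffler_renewal[OF a(1) t0pos] et0 by (simp add: e_def k_def)
  have R1: "((\<lambda>s. k (t1 - s) * (k s * e s)) has_integral k t1 * (1 - Gamma a * e t1)) {0..t1}"
    using mittag_leffler_renewal[OF a(1), of t1] t01 t0 by (simp add: e_def k_def)
  have "(\<lambda>s. k (t1 - s) * (k s * e s)) integrable_on {0..t0}"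
    and "(\<lambda>s. k (t1 - s) * (k s * e s)) integrable_on {t0..t1}"
    using R1 t0 t01 by (auto intro!: integrable_on_subinterval[OF has_integral_integrable[OF R1]])
  then obtain I J where I: "((\<lambda>s. k (t1 - s) * (k s * e s)) has_integral I) {0..t0}"
    and J: "((\<lambda>s. k (t1 - s) * (k s * e s)) has_integral J) {t0..t1}"
    unfolding integrable_on_def by blast
  have IJ: "I + J = k t1 * (1 - Gamma a * e t1)"
    using has_integral_combine[OF t0 less_imp_le[OF t01] I J] R1 has_integral_unique by blast
  have "J \<le> 0"
    using neg knn by (intro has_integral_le[OF J has_integral_0]) (auto intro!: mult_nonneg_nonpos)
  moreover have "I \<le> k t1 / k t0 * k t0"
  proof (rule has_integral_le[OF I has_integral_mult_right[OF R0, of "k t1 / k t0"]])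
    fix r assume r: "r \<in> {0..t0}"
    have "0 \<le> e r" using below[of r] et0 r by (cases "r = t0") auto
    show "k (t1 - r) * (k r * e r) \<le> k t1 / k t0 * (k (t0 - r) * (k r * e r))"
    proof (cases "r = t0")
      case True
      thus ?thesis by (simp add: et0)
    next
      case False
      with r have r': "0 \<le> r" "r < t0" by auto
      \<comment> \<open>the exponent a - 1 is not positive, so this inequality is reversed by k\<close>
      have "t1 * (t0 - r) \<le> t0 * (t1 - r)"
        using mult_left_mono[of t0 t1 r] r' t01 by (simp add: algebra_simps)
      hence "(t0 * (t1 - r)) powr (a - 1) \<le> (t1 * (t0 - r)) powr (a - 1)"
        using a r' t01 t0pos by (intro powr_mono2') auto
      hence "k t0 * k (t1 - r) \<le> k t1 * k (t0 - r)"
        using r' t01 t0pos by (simp add: k_def powr_mult)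
      hence "k (t1 - r) \<le> k t1 / k t0 * k (t0 - r)"
        using kpos[OF t0pos] by (simp add: field_simps)
      hence "k (t1 - r) * (k r * e r) \<le> (k t1 / k t0 * k (t0 - r)) * (k r * e r)"
        using \<open>0 \<le> e r\<close> knn by (intro mult_right_mono) auto
      thus ?thesis by (simp add: mult_ac)
    qed
  qed
  ultimately have "k t1 * (1 - Gamma a * e t1) \<le> k t1"
    using IJ kpos[OF t0pos] by simp
  hence "e t1 \<ge> 0"
    using kpos[of t1] t01 t0 Gamma_real_pos[OF a(1)] by (simp add: zero_le_mult_iff)
  thus False using t1(1) by (simp add: N_def)
qed

text \<open>
  The upper bound comes from the lower one: in the resolvent equation the convolution is nonnegative.
\<close>

lemma mittag_leffler_bounds:
  fixes a x :: real
  assumes a: "0 < a" "a \<le> 1" and x: "x \<ge> 0"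
  shows "0 \<le> mittag_leffler a a (- x)" and "mittag_leffler a a (- x) \<le> 1 / Gamma a"
proof -
  define t where "t = x powr (1 / a)"
  have xt: "x = t powr a" using a x by (simp add: t_def powr_powr)
  have t: "t \<ge> 0" by (simp add: t_def)
  have nn: "mittag_leffler a a (- (s powr a)) \<ge> 0" if "s \<ge> 0" for s
    using mittag_leffler_nonneg[OF a that] .
  show "0 \<le> mittag_leffler a a (- x)" using nn[OF t] xt by simp
  show "mittag_leffler a a (- x) \<le> 1 / Gamma a"
  proof (cases "t = 0")
    case True
    thus ?thesis using xt by (simp add: mittag_leffler_0)
  next
    case False
    with t have t: "t > 0" by simp
    have "0 \<le> t powr (a - 1) * (1 - Gamma a * mittag_leffler a a (- (t powr a)))"
      using nn by (intro has_integral_nonneg[OF mittag_leffler_renewal[OF a(1) t]]) auto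
    thus ?thesis
      using t Gamma_real_pos[OF a(1)] xt by (simp add: zero_le_mult_iff field_simps)
  qed
qed

section \<open>Inner products and spectral projections\<close>

lemma of_real_inner_one: "(of_real r :: 'k::{real_normed_field,euclidean_space}) \<bullet> 1 = r"
proof -
  have "(1::'k) \<bullet> 1 = 1" by (simp add: dot_square_norm)
  thus ?thesis by (simp add: of_real_def)
qed

lemma scalar_cnj_eq: "scalar_cnj z = (2 * (z \<bullet> 1)) *\<^sub>R 1 - z"
  by (simp add: scalar_cnj_def of_real_def)

lemma scalar_cnj_0 [simp]: "scalar_cnj 0 = 0"
  by (simp add: scalar_cnj_eq)

lemma scalar_cnj_add: "scalar_cnj (a + b) = scalar_cnj a + scalar_cnj b"
  by (simp add: scalar_cnj_eq inner_add_left algebra_simps)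

lemma scalar_cnj_of_real_mult: "scalar_cnj (of_real r * z) = of_real r * scalar_cnj z"
  by (simp add: scalar_cnj_eq scaleR_diff_right flip: scaleR_conv_of_real)

lemma scalar_cnj_inner_one: "scalar_cnj z \<bullet> 1 = z \<bullet> 1"
  using of_real_inner_one[of "2 * (z \<bullet> 1)", where 'k = 'a]
  by (simp add: scalar_cnj_def inner_diff_left del: of_real_mult)

text \<open>
  Conjugation is the reflection in the real axis, hence an isometry of the Euclidean structure.  This
  fact turns \<open>ip_self\<close> into the homogeneity of the norm under \<open>smul\<close>.
\<close>

lemma norm_scalar_cnj: "norm (scalar_cnj z) = norm z"
proof -
  have "norm (scalar_cnj z) = norm (of_real (2 * (z \<bullet> 1)) - z)" by (simp add: scalar_cnj_def)
  moreover have "(of_real (2 * (z \<bullet> 1)) - z) \<bullet> (of_real (2 * (z \<bullet> 1)) - z) = z \<bullet> z"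
    using of_real_inner_one[of 1, where 'k = 'a]
    by (simp add: of_real_def inner_diff_left inner_diff_right inner_commute[of 1 z])
  ultimately show ?thesis by (simp add: norm_eq_sqrt_inner)
qed

context hilbert_space
begin

lemma ip_add_right: "ip z (x + y) = ip z x + ip z y"
  by (metis ip_add_left ip_commute scalar_cnj_add)

lemma ip_scaleR_left: "ip (r *\<^sub>R x) y = of_real r * ip x y"
  by (simp flip: scale_of_real add: ip_scale_left)

lemma ip_scaleR_right: "ip x (r *\<^sub>R y) = of_real r * ip x y"
  by (metis ip_scaleR_left ip_commute scalar_cnj_of_real_mult)

lemma ip_minus_left: "ip (- x) y = - ip x y"
  using ip_scaleR_left[of "-1" x y] by simp

lemma ip_minus_right: "ip x (- y) = - ip x y"
  using ip_scaleR_right[of x "-1" y] by simp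

lemma ip_diff_left: "ip (x - y) z = ip x z - ip y z"
  using ip_add_left[of x "-y" z] by (simp add: ip_minus_left)

lemma ip_diff_right: "ip z (x - y) = ip z x - ip z y"
  using ip_add_right[of z x "-y"] by (simp add: ip_minus_right)

lemma ip_zero_right [simp]: "ip x 0 = 0"
  using ip_diff_right[of x 0 0] by simp

lemma ip_orthogonal_commute: "ip x y = 0 \<Longrightarrow> ip y x = 0"
  by (metis ip_commute scalar_cnj_0)

lemma norm_sq_eq_ip: "(norm x)\<^sup>2 = ip x x \<bullet> 1"
  by (simp add: ip_self of_real_inner_one del: of_real_power)

lemma norm_add_sq: "(norm (x + y))\<^sup>2 = (norm x)\<^sup>2 + 2 * (ip x y \<bullet> 1) + (norm y)\<^sup>2"
proof -
  have "ip y x \<bullet> 1 = ip x y \<bullet> 1" by (metis ip_commute scalar_cnj_inner_one)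
  thus ?thesis
    by (simp add: norm_sq_eq_ip ip_add_left ip_add_right inner_add_left)
qed

lemma norm_smul: "norm (smul a x) = norm a * norm x"
proof -
  have "of_real ((norm (smul a x))\<^sup>2) = a * scalar_cnj (a * of_real ((norm x)\<^sup>2))"
    by (metis ip_commute ip_scale_left ip_self)
  also have "\<dots> = a * (of_real ((norm x)\<^sup>2) * scalar_cnj a)"
    by (metis mult.commute scalar_cnj_of_real_mult)
  finally have "norm (of_real ((norm (smul a x))\<^sup>2) :: 'k) = norm (a * (of_real ((norm x)\<^sup>2) * scalar_cnj a))"
    by simp
  hence "(norm (smul a x))\<^sup>2 = (norm a * norm x)\<^sup>2"
    by (simp add: norm_mult norm_scalar_cnj norm_power power2_eq_square mult_ac)
  thus ?thesis by simp
qed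

text \<open>
  Cauchy--Schwarz.  For the real part it is the triangle inequality, squared and expanded; a unit
  scalar \<open>a\<close> that rotates \<open>ip x y\<close> onto the positive axis gives the general case.
\<close>

lemma norm_ip_le: "norm (ip x y) \<le> norm x * norm y"
proof (cases "ip x y = 0")
  case False
  have re: "ip u v \<bullet> 1 \<le> norm u * norm v" for u v
  proof -
    have "(norm (u + v))\<^sup>2 \<le> (norm u + norm v)\<^sup>2"
      by (intro power_mono norm_triangle_ineq) auto
    thus ?thesis unfolding norm_add_sq by (simp add: power2_sum)
  qed
  define a where "a = of_real (norm (ip x y)) / ip x y"
  have "norm (ip x y) = (a * ip x y) \<bullet> 1"
    using False by (simp add: a_def of_real_inner_one)
  also have "\<dots> \<le> norm (smul a x) * norm y"
    using re[of "smul a x" y] by (simp add: ip_scale_left)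
  also have "norm (smul a x) = norm x"
    using False by (simp add: norm_smul a_def norm_divide)
  finally show ?thesis .
qed auto

lemma bounded_linear_ip_left: "bounded_linear (\<lambda>x. ip x y)"
  by (rule bounded_linear_intro[where K = "norm y"])
     (simp_all add: ip_add_left ip_scaleR_left scaleR_conv_of_real norm_ip_le)

lemma bounded_linear_ip_right: "bounded_linear (\<lambda>y. ip x y)"
  by (rule bounded_linear_intro[where K = "norm x"])
     (use norm_ip_le[of x] in \<open>simp_all add: ip_add_right ip_scaleR_right scaleR_conv_of_real mult.commute[of _ "norm x"]\<close>)

lemma norm_sum_orthogonal_sq:
  assumes "finite F" "\<And>i j. i \<noteq> j \<Longrightarrow> ip (v i) (v j) = 0"
  shows "(norm (\<Sum>i\<in>F. v i))\<^sup>2 = (\<Sum>i\<in>F. (norm (v i))\<^sup>2)"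
  using assms(1)
proof (induction F rule: finite_induct)
  case (insert k F)
  have "ip (v k) (\<Sum>i\<in>F. v i) = (\<Sum>i\<in>F. ip (v k) (v i))"
    using bounded_linear_ip_right by (intro linear_sum bounded_linear.linear)
  also have "\<dots> = 0"
    using insert.hyps by (intro sum.neutral ballI assms(2)) auto
  finally show ?case using insert by (simp add: norm_add_sq)
qed auto

lemma summable_orthogonal:
  assumes orth: "\<And>i j. i \<noteq> j \<Longrightarrow> ip (v i) (v j) = 0"
    and sq: "summable (\<lambda>i. (norm (v i))\<^sup>2)"
  shows "summable v"
  unfolding summable_Cauchy
proof (intro allI impI)
  fix e :: real assume "e > 0"
  then obtain N where N: "\<And>m n. m \<ge> N \<Longrightarrow> norm (\<Sum>i\<in>{m..<n}. (norm (v i))\<^sup>2) < e\<^sup>2"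
    using sq unfolding summable_Cauchy by (meson zero_less_power)
  have "norm (\<Sum>i\<in>{m..<n}. v i) < e" if "m \<ge> N" for m n
  proof -
    have "(norm (\<Sum>i\<in>{m..<n}. v i))\<^sup>2 < e\<^sup>2"
      using N[OF that, of n] norm_sum_orthogonal_sq[of "{m..<n}" v] orth by (simp add: sum_nonneg)
    thus ?thesis using \<open>e > 0\<close> by (simp add: power2_less_imp_less)
  qed
  thus "\<exists>N. \<forall>m\<ge>N. \<forall>n. norm (\<Sum>i\<in>{m..<n}. v i) < e" by blast
qed

text \<open>
  Bessel's inequality: the partial sums of the \<open>v i\<close> are orthogonal projections of \<open>x\<close>.
\<close>

lemma bessel:
  assumes orth: "\<And>i j. i \<noteq> j \<Longrightarrow> ip (v i) (v j) = 0"
    and proj: "\<And>i. ip (x - v i) (v i) = 0"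
  shows "summable (\<lambda>i. (norm (v i))\<^sup>2)"
proof (rule summableI_nonneg_bounded)
  fix n
  define S where "S = (\<Sum>i<n. v i)"
  have "ip x S = (\<Sum>i<n. ip x (v i))"
    unfolding S_def using bounded_linear_ip_right by (intro linear_sum bounded_linear.linear)
  also have "\<dots> = (\<Sum>i<n. of_real ((norm (v i))\<^sup>2))"
    using proj by (intro sum.cong) (auto simp: ip_diff_left ip_self simp del: of_real_power)
  finally have "ip x S \<bullet> 1 = (\<Sum>i<n. (norm (v i))\<^sup>2)"
    by (simp add: of_real_inner_one flip: of_real_sum del: of_real_power)
  moreover have "(norm S)\<^sup>2 = (\<Sum>i<n. (norm (v i))\<^sup>2)"
    unfolding S_def using orth by (intro norm_sum_orthogonal_sq) auto
  moreover have "(norm (x + - S))\<^sup>2 \<ge> 0" by simp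
  ultimately show "(\<Sum>i<n. (norm (v i))\<^sup>2) \<le> (norm x)\<^sup>2"
    unfolding norm_add_sq by (simp add: ip_minus_right)
qed simp

lemma eigenspaces_orthogonal:
  assumes sa: "self_adjoint_operator ip D A"
    and v: "v \<in> eigenspace smul D (\<lambda>x. - A x) (of_real l)"
    and u: "u \<in> eigenspace smul D (\<lambda>x. - A x) (of_real m)" and "l \<noteq> m"
  shows "ip v u = 0"
proof -
  have Av: "A v = - (l *\<^sub>R v)" and Au: "A u = - (m *\<^sub>R u)" and D: "v \<in> D" "u \<in> D"
    using v u minus_minus[of "A v"] minus_minus[of "A u"]
    by (auto simp: eigenspace_def scale_of_real simp del: minus_minus)
  have "ip (A v) u = ip v (A u)" using sa D by (auto simp: self_adjoint_operator_def)
  hence "of_real l * ip v u = of_real m * ip v u"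
    by (simp add: Av Au ip_minus_left ip_minus_right ip_scaleR_left ip_scaleR_right)
  thus ?thesis using \<open>l \<noteq> m\<close> by simp
qed

lemma spectral_projections_orthogonal:
  assumes sa: "self_adjoint_operator ip D A"
    and sd: "spectral_decomposition smul ip D (\<lambda>x. - A x) lam P" and "i \<noteq> j"
  shows "ip (P i x) (P j y) = 0"
proof (rule eigenspaces_orthogonal[OF sa])
  show "P i x \<in> eigenspace smul D (\<lambda>x. - A x) (of_real (lam i))"
       "P j y \<in> eigenspace smul D (\<lambda>x. - A x) (of_real (lam j))"
    using sd by (auto simp: spectral_decomposition_def is_orthogonal_projection_def)
  show "lam i \<noteq> lam j"
    using sd \<open>i \<noteq> j\<close> strict_mono_eq by (auto simp: spectral_decomposition_def)
qed

lemma spectral_projection_self_adjoint: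
  assumes sd: "spectral_decomposition smul ip D B lam P"
  shows "ip (P n x) y = ip (P n x) (P n y)" and "ip x (P n y) = ip (P n x) (P n y)"
proof -
  have *: "ip (u - P n u) (P n v) = 0" for u v
    using sd by (auto simp: spectral_decomposition_def is_orthogonal_projection_def)
  show "ip (P n x) y = ip (P n x) (P n y)"
    using ip_orthogonal_commute[OF *[of y x]] by (simp add: ip_diff_right)
  show "ip x (P n y) = ip (P n x) (P n y)"
    using *[of x y] by (simp add: ip_diff_left)
qed

lemma summable_spectral_projections_sq:
  assumes sa: "self_adjoint_operator ip D A"
    and sd: "spectral_decomposition smul ip D (\<lambda>x. - A x) lam P"
  shows "summable (\<lambda>n. (norm (P n x))\<^sup>2)"
  using spectral_projections_orthogonal[OF sa sd]
  by (rule bessel[where x = x])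
     (simp_all only: ip_diff_left spectral_projection_self_adjoint(2)[OF sd, of x _ x] diff_self not_False_eq_True)

text \<open>
  Completeness of the spectral projections.  Let \<open>q = \<Sum>\<^sub>n P n x\<close>, which exists by Bessel's inequality.
  As \<open>A q = A x\<close> in the weak sense that \<open>ip (A y) (q - x) = 0\<close> for all \<open>y \<in> D\<close>, the vector \<open>q - x\<close>
  lies in the domain of the adjoint, which is \<open>D\<close>; taking \<open>y = q - x\<close>, the positive lower bound of
  \<open>-A\<close> forces \<open>q = x\<close>.
\<close>

lemma spectral_projections_sums:
  assumes sa: "self_adjoint_operator ip D A"
    and bb: "bounded_below_by ip D (\<lambda>x. - A x) (lam 0)"
    and sd: "spectral_decomposition smul ip D (\<lambda>x. - A x) lam P"
    and x: "x \<in> D"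
  shows "(\<lambda>n. P n x) sums x"
proof -
  have "summable (\<lambda>n. P n x)"
    using spectral_projections_orthogonal[OF sa sd] summable_spectral_projections_sq[OF sa sd]
    by (rule summable_orthogonal)
  then obtain q where q: "(\<lambda>n. P n x) sums q" by (auto simp: summable_def)
  have PE: "P n x \<in> eigenspace smul D (\<lambda>x. - A x) (of_real (lam n))" for n
    using sd by (auto simp: spectral_decomposition_def is_orthogonal_projection_def)
  have PD: "P n x \<in> D" and AP: "A (P n x) = - (lam n *\<^sub>R P n x)" for n
    using PE[of n] minus_minus[of "A (P n x)"]
    by (auto simp: eigenspace_def scale_of_real simp del: minus_minus)
  have sym: "ip (A y) z = ip y (A z)" if "y \<in> D" "z \<in> D" for y z
    using sa that by (auto simp: self_adjoint_operator_def)
  have zero: "ip (A y) (q - x) = 0" if y: "y \<in> D" for y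
  proof -
    have "(\<lambda>n. ip (A y) (P n x)) sums ip (A y) q"
      by (rule bounded_linear.sums[OF bounded_linear_ip_right q])
    moreover have "ip (A y) (P n x) = - ip y (lam n *\<^sub>R P n x)" for n
      using sym[OF y PD] by (simp add: AP ip_minus_right)
    moreover have "(\<lambda>n. - ip y (lam n *\<^sub>R P n x)) sums - ip y (- A x)"
      using sd x by (intro sums_minus bounded_linear.sums[OF bounded_linear_ip_right])
        (auto simp: spectral_decomposition_def)
    ultimately have "ip (A y) q = ip y (A x)"
      by (simp add: sums_unique2 ip_minus_right)
    thus ?thesis using sym[OF y x] by (simp add: ip_diff_right)
  qed
  hence "q - x \<in> adjoint_domain ip D A"
    unfolding adjoint_domain_def by (auto intro!: exI[of _ 0])
  hence D: "q - x \<in> D" using sa by (simp add: self_adjoint_operator_def)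
  have "lam 0 * (norm (q - x))\<^sup>2 \<le> ip (- A (q - x)) (q - x) \<bullet> 1"
    using bb D by (auto simp: bounded_below_by_def)
  also have "\<dots> = 0" using zero[OF D] by (simp add: ip_minus_left)
  finally have "(norm (q - x))\<^sup>2 \<le> 0"
    using sd by (auto simp: spectral_decomposition_def mult_le_0_iff)
  hence "q = x" by simp
  thus ?thesis using q by simp
qed

lemma ip_spectral_projections_sums:
  assumes "self_adjoint_operator ip D A"
    and "bounded_below_by ip D (\<lambda>x. - A x) (lam 0)"
    and sd: "spectral_decomposition smul ip D (\<lambda>x. - A x) lam P"
    and "y \<in> D"
  shows "(\<lambda>n. ip (P n x) y) sums ip x y"
  using bounded_linear.sums[OF bounded_linear_ip_right spectral_projections_sums[OF assms], of x]
  by (simp only: trans[OF spectral_projection_self_adjoint(1)[OF sd]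
        spectral_projection_self_adjoint(2)[OF sd, symmetric]])

lemma summable_norm_ip_spectral_projections:
  assumes "self_adjoint_operator ip D A"
    and sd: "spectral_decomposition smul ip D (\<lambda>x. - A x) lam P"
  shows "summable (\<lambda>n. norm (ip (P n x) y))"
proof (rule summable_comparison_test')
  show "summable (\<lambda>n. (norm (P n x))\<^sup>2 + (norm (P n y))\<^sup>2)"
    by (intro summable_add summable_spectral_projections_sq[OF assms])
  fix n
  have "norm (ip (P n x) y) \<le> norm (P n x) * norm (P n y)"
    by (subst spectral_projection_self_adjoint(1)[OF sd]) (rule norm_ip_le)
  also have "\<dots> \<le> (norm (P n x))\<^sup>2 + (norm (P n y))\<^sup>2"
    using sum_squares_bound[of "norm (P n x)" "norm (P n y)"]
      mult_nonneg_nonneg[OF norm_ge_zero[of "P n x"] norm_ge_zero[of "P n y"]] by linarith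
  finally show "norm (norm (ip (P n x) y)) \<le> (norm (P n x))\<^sup>2 + (norm (P n y))\<^sup>2" by simp
qed

text \<open>
  Bounded coefficients keep the orthogonal series convergent, and the continuous functional \<open>ip _ y\<close>
  passes through its sum.
\<close>

lemma ip_spectral_multiplier:
  assumes "self_adjoint_operator ip D A"
    and sd: "spectral_decomposition smul ip D (\<lambda>x. - A x) lam P"
    and bound: "\<And>n. norm (c n) \<le> K"
  shows "ip (\<Sum>n. smul (c n) (P n x)) y = (\<Sum>n. c n * ip (P n x) y)"
proof -
  have "summable (\<lambda>n. smul (c n) (P n x))"
  proof (rule summable_orthogonal)
    fix i j :: nat assume "i \<noteq> j"
    hence "ip (smul (c j) (P j x)) (P i x) = 0"
      by (simp add: ip_scale_left spectral_projections_orthogonal[OF assms(1,2)])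
    thus "ip (smul (c i) (P i x)) (smul (c j) (P j x)) = 0"
      by (simp add: ip_scale_left ip_orthogonal_commute)
  next
    have "summable (\<lambda>n. K\<^sup>2 * (norm (P n x))\<^sup>2)"
      by (intro summable_mult summable_spectral_projections_sq[OF assms(1,2)])
    thus "summable (\<lambda>n. (norm (smul (c n) (P n x)))\<^sup>2)"
      by (rule summable_comparison_test'[where N = 0])
         (auto simp: norm_smul power_mult_distrib intro!: mult_right_mono power_mono bound)
  qed
  from bounded_linear.suminf[OF bounded_linear_ip_left this] show ?thesis
    by (simp add: ip_scale_left)
qed

end

section \<open>Convolution with the Mittag-Leffler kernel\<close>

lemma set_lebesgue_integral_Ioo:
  fixes f :: "real \<Rightarrow> 'a::{banach,second_countable_topology}"
  shows
  "(LINT s:{a<..<b::real}|lebesgue. f s) = integral\<^sup>L (lebesgue_on {a<..<b}) f"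
  unfolding set_lebesgue_integral_def by (subst integral_restrict_space) auto

lemma RL_kernel_integral:
  fixes a t :: real
  assumes "a > 0" "t > 0"
  shows "integrable (lebesgue_on {0<..<t}) (\<lambda>s. (t - s) powr (a - 1))"
    and "integral\<^sup>L (lebesgue_on {0<..<t}) (\<lambda>s. (t - s) powr (a - 1)) = t powr a / a"
proof -
  have B: "Beta 1 a = 1 / a"
  proof -
    have "Gamma (1 + a) = a * Gamma a"
      using Gamma_plus1[OF pos_not_nonpos_Int[OF assms(1)]] by (simp add: add.commute)
    thus ?thesis using Gamma_real_pos[OF assms(1)] by (simp add: Beta_def del: Gamma_real_pos)
  qed
  have "((\<lambda>s. (t - s) powr (a - 1) * s powr (1 - 1)) has_integral t powr (1 + a - 1) * Beta 1 a) {0<..<t}"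
    using has_integral_Beta_scaled[of 1 a t] assms by (simp add: has_integral_Icc_iff_Ioo)
  hence I: "((\<lambda>s. (t - s) powr (a - 1)) has_integral t powr a / a) {0<..<t}"
    unfolding B by (auto elim!: has_integral_eq[rotated])
  hence ai: "(\<lambda>s. (t - s) powr (a - 1)) absolutely_integrable_on {0<..<t}"
    by (intro nonnegative_absolutely_integrable_1) (auto simp: integrable_on_def)
  thus "integrable (lebesgue_on {0<..<t}) (\<lambda>s. (t - s) powr (a - 1))"
    by (simp add: set_integrable_def integrable_restrict_space)
  show "integral\<^sup>L (lebesgue_on {0<..<t}) (\<lambda>s. (t - s) powr (a - 1)) = t powr a / a"
    using set_lebesgue_integral_eq_integral(2)[OF ai] I
    by (simp add: set_lebesgue_integral_Ioo integral_unique)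
qed

lemma norm_RL_kernel_integral_le:
  fixes h :: "real \<Rightarrow> 'a::{banach,second_countable_topology}"
  assumes "a > 0" "t > 0" "K \<ge> 0"
    and h: "AE s in lebesgue_on {0<..<t}. norm (h s) \<le> K"
  shows "norm (integral\<^sup>L (lebesgue_on {0<..<t}) (\<lambda>s. (t - s) powr (a - 1) *\<^sub>R h s)) \<le> K * t powr a / a"
proof (cases "integrable (lebesgue_on {0<..<t}) (\<lambda>s. (t - s) powr (a - 1) *\<^sub>R h s)")
  case True
  let ?M = "lebesgue_on {0<..<t}"
  have "norm (integral\<^sup>L ?M (\<lambda>s. (t - s) powr (a - 1) *\<^sub>R h s))
      \<le> integral\<^sup>L ?M (\<lambda>s. norm ((t - s) powr (a - 1) *\<^sub>R h s))"
    by (rule integral_norm_bound)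
  also have "\<dots> \<le> integral\<^sup>L ?M (\<lambda>s. K * (t - s) powr (a - 1))"
  proof (rule integral_mono_AE)
    show "integrable ?M (\<lambda>s. norm ((t - s) powr (a - 1) *\<^sub>R h s))"
      using True by (rule integrable_norm)
    show "integrable ?M (\<lambda>s. K * (t - s) powr (a - 1))"
      by (intro integrable_mult_right RL_kernel_integral assms)
    show "AE s in ?M. norm ((t - s) powr (a - 1) *\<^sub>R h s) \<le> K * (t - s) powr (a - 1)"
      using h by eventually_elim (simp add: mult.commute mult_right_mono)
  qed
  also have "\<dots> = K * t powr a / a"
    using RL_kernel_integral(2)[OF assms(1,2)] by simp
  finally show ?thesis .
next
  \<comment> \<open>an integral that does not exist has the value 0\<close>
  case False
  thus ?thesis using assms by (simp add: not_integrable_integral_eq)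
qed

text \<open>
  The coefficient of \<open>P\<^sub>n f\<close> in the solution \<open>u\<^bsub>p,a\<^esub>\<close>, with \<open>l = \<lambda>\<^sub>n\<close>.
\<close>

definition ml_convolution :: "real \<Rightarrow> real \<Rightarrow> (real \<Rightarrow> 'k::{real_normed_field,euclidean_space}) \<Rightarrow> real \<Rightarrow> 'k" where
  "ml_convolution a l p t = (LINT s:{0<..<t}|lebesgue.
     ((t - s) powr (a - 1) * mittag_leffler a a (- l * (t - s) powr a)) *\<^sub>R p s)"

lemma ml_convolution_eq:
  "ml_convolution a l p t = integral\<^sup>L (lebesgue_on {0<..<t})
     (\<lambda>s. (t - s) powr (a - 1) *\<^sub>R (mittag_leffler a a (- l * (t - s) powr a) *\<^sub>R p s))"
  by (simp add: ml_convolution_def set_lebesgue_integral_Ioo)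

context
  fixes a l T :: real and p :: "real \<Rightarrow> 'k::{real_normed_field,euclidean_space}"
  assumes a: "0 < a" "a \<le> 1" and l: "l \<ge> 0" and T: "T > 0" and p: "continuous_on {0..T} p"
begin

lemma mittag_leffler_abs_le: "\<bar>mittag_leffler a a (- l * u powr a)\<bar> \<le> 1 / Gamma a"
  using mittag_leffler_bounds[OF a, of "l * u powr a"] l by simp

lemma norm_mittag_leffler_scaleR_le:
  assumes "norm v \<le> B"
  shows "norm (mittag_leffler a a (- l * u powr a) *\<^sub>R (v :: 'k)) \<le> 1 / Gamma a * B"
  unfolding norm_scaleR real_norm_def using a
  by (intro mult_mono mittag_leffler_abs_le assms) (auto simp: less_imp_le)

text \<open>
  The bound does not depend on \<open>l\<close>.  This uniformity over the spectrum is what allows limits to be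
  taken inside the eigenfunction series.
\<close>

lemma norm_ml_convolution_le:
  assumes t: "0 < t" "t \<le> T" and B: "\<And>s. s \<in> {0..T} \<Longrightarrow> norm (p s) \<le> B"
  shows "norm (ml_convolution a l p t) \<le> (1 / Gamma a * B) * t powr a / a"
  unfolding ml_convolution_eq
proof (rule norm_RL_kernel_integral_le)
  have "B \<ge> 0" using order_trans[OF norm_ge_zero B[of 0]] T by simp
  thus "0 \<le> 1 / Gamma a * B" using a by (simp add: less_imp_le)
  show "AE s in lebesgue_on {0<..<t}. norm (mittag_leffler a a (- l * (t - s) powr a) *\<^sub>R p s) \<le> 1 / Gamma a * B"
    using t by (intro AE_I2 norm_mittag_leffler_scaleR_le B) auto
qed (use a t in auto)

lemma ml_convolution_integrable:
  assumes t: "0 < t" "t \<le> T"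
  shows "integrable (lebesgue_on {0<..<t})
    (\<lambda>s. (t - s) powr (a - 1) *\<^sub>R (mittag_leffler a a (- l * (t - s) powr a) *\<^sub>R p s))"
proof -
  obtain B where B: "\<And>s. s \<in> {0..T} \<Longrightarrow> norm (p s) \<le> B"
    using compact_imp_bounded[OF compact_continuous_image[OF p compact_Icc]]
    unfolding bounded_iff by blast
  have "continuous_on {0<..<t} (\<lambda>s. mittag_leffler a a (- l * (t - s) powr a))"
    by (rule continuous_on_compose2[OF continuous_on_mittag_leffler_powr[OF a(1) a(1)]])
       (auto intro!: continuous_intros)
  moreover have "continuous_on {0<..<t} p"
    using p t by (rule_tac continuous_on_subset) auto
  ultimately have "continuous_on {0<..<t} (\<lambda>s. (t - s) powr (a - 1) *\<^sub>R (mittag_leffler a a (- l * (t - s) powr a) *\<^sub>R p s))"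
    by (auto intro!: continuous_intros)
  hence meas: "(\<lambda>s. (t - s) powr (a - 1) *\<^sub>R (mittag_leffler a a (- l * (t - s) powr a) *\<^sub>R p s))
      \<in> borel_measurable (lebesgue_on {0<..<t})"
    by (rule continuous_imp_measurable_on_sets_lebesgue) auto
  show ?thesis
  proof (rule Bochner_Integration.integrable_bound[OF _ meas])
    show "integrable (lebesgue_on {0<..<t}) (\<lambda>s. (1 / Gamma a * B) * (t - s) powr (a - 1))"
      by (intro integrable_mult_right RL_kernel_integral a t)
    show "AE s in lebesgue_on {0<..<t}. norm ((t - s) powr (a - 1) *\<^sub>R (mittag_leffler a a (- l * (t - s) powr a) *\<^sub>R p s))
       \<le> norm ((1 / Gamma a * B) * (t - s) powr (a - 1))"
    proof (intro AE_I2)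
      fix s assume "s \<in> space (lebesgue_on {0<..<t})"
      hence "norm (p s) \<le> B" using t by (intro B) auto
      hence "norm (mittag_leffler a a (- l * (t - s) powr a) *\<^sub>R p s) \<le> 1 / Gamma a * B"
        by (rule norm_mittag_leffler_scaleR_le)
      also have "\<dots> \<le> \<bar>1 / Gamma a * B\<bar>" by (rule abs_ge_self)
      finally show "norm ((t - s) powr (a - 1) *\<^sub>R (mittag_leffler a a (- l * (t - s) powr a) *\<^sub>R p s))
       \<le> norm ((1 / Gamma a * B) * (t - s) powr (a - 1))"
        unfolding norm_scaleR[of "(t - s) powr (a - 1)"] real_norm_def
          abs_mult[of "1 / Gamma a * B"] mult.commute[of "\<bar>(t - s) powr (a - 1)\<bar>"]
        by (intro mult_right_mono) auto
    qed
  qed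
qed

text \<open>
  Near \<open>t = 0\<close> the factors \<open>E\<^bsub>a,a\<^esub>(-l (t - s) powr a)\<close> and \<open>p s\<close> are close to \<open>1 / Gamma a\<close> and \<open>p 0\<close>,
  and \<open>(t - s) powr (a - 1)\<close> has the integral \<open>t powr a / a\<close>; so \<open>l\<close> does not enter the limit.
\<close>

lemma ml_convolution_asymptotics:
  "((\<lambda>t. ml_convolution a l p t /\<^sub>R t powr a) \<longlongrightarrow> p 0 /\<^sub>R (a * Gamma a)) (at_right 0)"
proof (rule tendstoI)
  fix e :: real assume e: "e > 0"
  let ?E = "\<lambda>u. mittag_leffler a a (- l * u powr a)"
  define c where "c = 1 / Gamma a"
  have c: "c > 0" using a by (simp add: c_def)
  \<comment> \<open>the final error is d / a; d1 and d2 split d between the errors of p and of the Mittag-Leffler factor\<close>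
  define d where "d = e * a / 2"
  have d: "d > 0" using e a by (simp add: d_def)
  define d1 where "d1 = d / (2 * c)"
  \<comment> \<open>1 is added in the denominator because p 0 may vanish\<close>
  define d2 where "d2 = (d / 2) / (norm (p 0) + 1)"
  have d12: "d1 > 0" "d2 > 0" using d c by (auto simp: d1_def d2_def intro!: divide_pos_pos add_nonneg_pos)
  have "(p \<longlongrightarrow> p 0) (at 0 within {0..T})"
    using p T by (simp add: continuous_on_def)
  then obtain r1 where r1: "r1 > 0" "\<And>s. s \<in> {0..T} \<Longrightarrow> 0 < \<bar>s\<bar> \<Longrightarrow> \<bar>s\<bar> < r1 \<Longrightarrow> norm (p s - p 0) < d1"
    using d12 unfolding Lim_within by (auto simp: dist_norm)
  have "continuous_on {0..} ?E"
    by (rule continuous_on_mittag_leffler_powr[OF a(1) a(1)])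
  moreover have "?E 0 = c" using mittag_leffler_0[of a a, where 'a = real] by (simp add: c_def)
  ultimately obtain r2 where r2: "r2 > 0" "\<And>u. u \<ge> 0 \<Longrightarrow> \<bar>u\<bar> < r2 \<Longrightarrow> \<bar>?E u - c\<bar> < d2"
    using d12 unfolding continuous_on_iff by (force simp: dist_real_def)
  define r where "r = min T (min r1 r2)"
  have r: "r > 0" using T r1 r2 by (simp add: r_def)
  have "dist (ml_convolution a l p t /\<^sub>R t powr a) (p 0 /\<^sub>R (a * Gamma a)) < e" if t: "0 < t" "t < r" for t
  proof -
    let ?M = "lebesgue_on {0<..<t}"
    have tT: "t \<le> T" using t by (simp add: r_def)
    have "integral\<^sup>L ?M (\<lambda>s. (t - s) powr (a - 1) *\<^sub>R (c *\<^sub>R p 0)) = (t powr a / a) *\<^sub>R (c *\<^sub>R p 0)"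
      using RL_kernel_integral[OF a(1) t(1)] by (subst integral_scaleR_left) auto
    moreover have "integrable ?M (\<lambda>s. (t - s) powr (a - 1) *\<^sub>R (c *\<^sub>R p 0))"
      using RL_kernel_integral[OF a(1) t(1)] by (intro integrable_scaleR_left)
    ultimately have "ml_convolution a l p t - (t powr a / a) *\<^sub>R (c *\<^sub>R p 0) =
       integral\<^sup>L ?M (\<lambda>s. (t - s) powr (a - 1) *\<^sub>R (?E (t - s) *\<^sub>R p s - c *\<^sub>R p 0))"
      using ml_convolution_integrable[OF t(1) tT]
      by (simp add: ml_convolution_eq scaleR_diff_right Bochner_Integration.integral_diff)
    also have "norm \<dots> \<le> d * t powr a / a"
    proof (rule norm_RL_kernel_integral_le)
      show "AE s in ?M. norm (?E (t - s) *\<^sub>R p s - c *\<^sub>R p 0) \<le> d"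
      proof (intro AE_I2)
        fix s assume "s \<in> space ?M"
        hence s: "0 < s" "s < t" by auto
        have "?E (t - s) *\<^sub>R p s - c *\<^sub>R p 0 = ?E (t - s) *\<^sub>R (p s - p 0) + (?E (t - s) - c) *\<^sub>R p 0"
          by (simp add: algebra_simps)
        also have "norm \<dots> \<le> \<bar>?E (t - s)\<bar> * norm (p s - p 0) + \<bar>?E (t - s) - c\<bar> * norm (p 0)"
          by (rule norm_triangle_le) simp
        also have "\<bar>?E (t - s)\<bar> * norm (p s - p 0) \<le> c * d1"
          using r1(2)[of s] s t c mittag_leffler_abs_le[of "t - s"]
          by (intro mult_mono) (auto simp: r_def c_def)
        also have "\<bar>?E (t - s) - c\<bar> * norm (p 0) \<le> d2 * (norm (p 0) + 1)"
          using r2(2)[of "t - s"] s t d12 by (intro mult_mono) (auto simp: r_def)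
        also have "c * d1 + d2 * (norm (p 0) + 1) = d"
        proof -
          have "norm (p 0) + 1 \<noteq> 0" using norm_ge_zero[of "p 0"] by linarith
          hence "d2 * (norm (p 0) + 1) = d / 2" unfolding d2_def by (rule nonzero_eq_divide_eq[THEN iffD1]) simp
          thus ?thesis using c by (simp add: d1_def)
        qed
        finally show "norm (?E (t - s) *\<^sub>R p s - c *\<^sub>R p 0) \<le> d" by simp
      qed
    qed (use a t d in auto)
    finally have le: "norm (ml_convolution a l p t - (t powr a / a) *\<^sub>R (c *\<^sub>R p 0)) \<le> d * t powr a / a" .
    have "ml_convolution a l p t /\<^sub>R t powr a - p 0 /\<^sub>R (a * Gamma a)
       = (ml_convolution a l p t - (t powr a / a) *\<^sub>R (c *\<^sub>R p 0)) /\<^sub>R t powr a"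
      using t by (simp add: c_def scaleR_diff_right field_simps)
    hence "norm (ml_convolution a l p t /\<^sub>R t powr a - p 0 /\<^sub>R (a * Gamma a))
       = norm (ml_convolution a l p t - (t powr a / a) *\<^sub>R (c *\<^sub>R p 0)) / t powr a"
      by (simp add: divide_inverse mult.commute)
    also have "\<dots> \<le> (d * t powr a / a) / t powr a"
      using le by (intro divide_right_mono) auto
    also have "\<dots> = e / 2" using t a by (simp add: d_def)
    also have "\<dots> < e" using e by simp
    finally show ?thesis by (simp add: dist_norm)
  qed
  thus "\<forall>\<^sub>F t in at_right 0. dist (ml_convolution a l p t /\<^sub>R t powr a) (p 0 /\<^sub>R (a * Gamma a)) < e"
    using r unfolding eventually_at_right_field by blast
qed

end

section \<open>Short-time asymptotics of the observation\<close>

text \<open>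
  Every coefficient of the series has the same leading behaviour \<open>p 0 \<cdot> t powr a / (a Gamma a)\<close>.
  By Tannery's theorem, with the summable majorant \<open>K |ip (P n f) \<psi>|\<close>, the limits add up; and
  \<open>\<Sum>\<^sub>n ip (P n f) \<psi> = ip f \<psi>\<close> because \<open>\<psi>\<close> lies in the domain of \<open>A\<close>.
\<close>

lemma (in hilbert_space) observation_asymptotics:
  assumes a: "0 < a" "a \<le> 1" and T: "T > 0" and p: "continuous_on {0..T} p"
    and sa: "self_adjoint_operator ip D A"
    and bb: "bounded_below_by ip D (\<lambda>x. - A x) (lam 0)"
    and sd: "spectral_decomposition smul ip D (\<lambda>x. - A x) lam P"
    and \<psi>: "\<psi> \<in> D"
  shows "((\<lambda>t. observation smul ip lam P f \<psi> p a t /\<^sub>R t powr a) \<longlongrightarrow> (p 0 * ip f \<psi>) /\<^sub>R (a * Gamma a)) (at_right 0)"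
proof -
  define c where "c = (\<lambda>n t. ml_convolution a (lam n) p t)"
  define d where "d = (\<lambda>n. ip (P n f) \<psi>)"
  obtain B where B: "\<And>s. s \<in> {0..T} \<Longrightarrow> norm (p s) \<le> B"
    using compact_imp_bounded[OF compact_continuous_image[OF p compact_Icc]]
    unfolding bounded_iff by blast
  have lam: "lam n \<ge> 0" for n
    using sd strict_mono_leD[of lam 0 n] by (auto simp: spectral_decomposition_def)
  define K where "K = 1 / Gamma a * B / a"
  have c_le: "norm (c n t) \<le> K * t powr a" if "0 < t" "t < T" for n t
    using norm_ml_convolution_le[OF a lam T p, of t B n] that B by (simp add: c_def K_def)
  have c_lim: "((\<lambda>t. c n t /\<^sub>R t powr a) \<longlongrightarrow> p 0 /\<^sub>R (a * Gamma a)) (at_right 0)" for n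
    unfolding c_def by (rule ml_convolution_asymptotics[OF a lam T p])
  have small: "\<forall>\<^sub>F t in at_right 0. 0 < t \<and> t < T"
    using T unfolding eventually_at_right_field by blast
  have obs: "observation smul ip lam P f \<psi> p a t = (\<Sum>n. c n t * d n)" if "0 < t" "t < T" for t
    unfolding observation_def solution_def d_def c_def
    unfolding ml_convolution_def[symmetric]
    by (rule ip_spectral_multiplier[OF sa sd]) (use c_le[OF that] in \<open>simp add: c_def\<close>)
  have dsum: "summable (\<lambda>n. norm (d n))"
    unfolding d_def by (rule summable_norm_ip_spectral_projections[OF sa sd])
  have "(\<lambda>n. (p 0 /\<^sub>R (a * Gamma a)) * d n) sums ((p 0 /\<^sub>R (a * Gamma a)) * ip f \<psi>)"
    unfolding d_def by (intro sums_mult ip_spectral_projections_sums[OF sa bb sd \<psi>])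
  hence lim_eq: "(\<Sum>n. (p 0 /\<^sub>R (a * Gamma a)) * d n) = (p 0 * ip f \<psi>) /\<^sub>R (a * Gamma a)"
    by (simp add: sums_iff)
  have tan: "(\<forall>\<^sub>F t in at_right 0. summable (\<lambda>n. norm ((c n t /\<^sub>R t powr a) * d n))) \<and>
      summable (\<lambda>n. norm ((p 0 /\<^sub>R (a * Gamma a)) * d n)) \<and>
      ((\<lambda>t. \<Sum>n. (c n t /\<^sub>R t powr a) * d n) \<longlongrightarrow> (\<Sum>n. (p 0 /\<^sub>R (a * Gamma a)) * d n)) (at_right 0)"
  proof (rule tannerys_theorem)
    show "((\<lambda>t. (c n t /\<^sub>R t powr a) * d n) \<longlongrightarrow> (p 0 /\<^sub>R (a * Gamma a)) * d n) (at_right 0)" for n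
      by (intro tendsto_mult c_lim tendsto_const)
    show "\<forall>\<^sub>F (n, t) in sequentially \<times>\<^sub>F at_right 0. norm ((c n t /\<^sub>R t powr a) * d n) \<le> K * norm (d n)"
      unfolding eventually_prod_filter
    proof (intro exI conjI allI impI)
      show "\<forall>\<^sub>F n in sequentially. True" by simp
      show "\<forall>\<^sub>F t in at_right 0. 0 < t \<and> t < T" by (rule small)
      fix n t assume "0 < t \<and> t < T"
      hence t: "0 < t" "t < T" by auto
      have "norm (c n t /\<^sub>R t powr a) \<le> K"
        using c_le[OF t, of n] t by (simp add: field_simps)
      thus "case (n, t) of (n, t) \<Rightarrow> norm ((c n t /\<^sub>R t powr a) * d n) \<le> K * norm (d n)"
        unfolding prod.case norm_mult by (intro mult_right_mono) auto
    qed
    show "summable (\<lambda>n. K * norm (d n))" by (intro summable_mult dsum)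
  qed simp
  have "\<forall>\<^sub>F t in at_right 0. (\<Sum>n. (c n t /\<^sub>R t powr a) * d n) = observation smul ip lam P f \<psi> p a t /\<^sub>R t powr a"
    using conjunct1[OF tan] small
  proof eventually_elim
    case (elim t)
    have "summable (\<lambda>n. (c n t /\<^sub>R t powr a) * d n)"
      using elim(1) by (rule summable_norm_cancel)
    hence "(\<Sum>n. t powr a *\<^sub>R ((c n t /\<^sub>R t powr a) * d n)) = t powr a *\<^sub>R (\<Sum>n. (c n t /\<^sub>R t powr a) * d n)"
      by (rule suminf_scaleR_right[symmetric])
    moreover have "t powr a *\<^sub>R ((c n t /\<^sub>R t powr a) * d n) = c n t * d n" for n
      using elim by simp
    ultimately show ?case using elim obs[of t] by simp
  qed
  from Lim_transform_eventually[OF conjunct2[OF conjunct2[OF tan]] this] show ?thesis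
    by (simp only: lim_eq)
qed

section \<open>Bounded fractional derivatives and distinct orders\<close>

lemma rl_integral_Linf_bound:
  fixes g :: "real \<Rightarrow> 'a::{banach,second_countable_topology}"
  assumes "\<rho> > 0" and g: "g \<in> Linf_space T"
  obtains C where "\<And>t. 0 < t \<Longrightarrow> t < T \<Longrightarrow> norm (rl_integral \<rho> g t) \<le> C * t powr \<rho>"
proof -
  have "Linf_norm T g < \<infinity>" using g by (simp add: Linf_space_def)
  then obtain K where K: "Linf_norm T g \<le> ereal K" "K \<ge> 0"
  proof (cases "Linf_norm T g")
    case (real r)
    thus ?thesis by (intro that[of "max 0 r"]) auto
  next
    case MInf
    thus ?thesis by (intro that[of 0]) auto
  qed auto
  have "AE s in lebesgue_on {0<..<T}. ereal (norm (g s)) \<le> Linf_norm T g"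
    unfolding Linf_norm_def by (rule esssup_AE)
  hence "AE s in lebesgue_on {0<..<T}. norm (g s) \<le> K"
    by eventually_elim (use K in \<open>auto dest: order_trans\<close>)
  hence AE: "AE s in lebesgue. s \<in> {0<..<T} \<longrightarrow> norm (g s) \<le> K"
    by (simp add: AE_restrict_space_iff)
  show ?thesis
  proof
    fix t assume t: "0 < t" "t < T"
    have "AE s in lebesgue_on {0<..<t}. norm (g s) \<le> K"
      unfolding AE_restrict_space_iff[of "{0<..<t}" lebesgue, simplified]
      using AE by eventually_elim (use t in auto)
    from norm_RL_kernel_integral_le[OF assms(1) t(1) K(2) this]
    have "norm (rl_integral \<rho> g t) \<le> \<bar>1 / Gamma \<rho>\<bar> * (K * t powr \<rho> / \<rho>)"
      unfolding rl_integral_def set_lebesgue_integral_Ioo norm_scaleR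
      by (intro mult_left_mono) auto
    thus "norm (rl_integral \<rho> g t) \<le> (\<bar>1 / Gamma \<rho>\<bar> * K / \<rho>) * t powr \<rho>" by simp
  qed
qed

text \<open>
  A function of exact order \<open>t powr \<alpha>\<close> exceeds every \<open>C t powr \<rho>\<close> with \<open>\<rho> > \<alpha>\<close> on a whole interval
  \<open>(0, r)\<close>, which is not a null set.
\<close>

lemma no_AE_bound_of_smaller_order:
  fixes w :: "real \<Rightarrow> 'a::real_normed_vector"
  assumes "T > 0" "\<alpha> < \<rho>" and "L \<noteq> 0"
    and lim: "((\<lambda>t. w t /\<^sub>R t powr \<alpha>) \<longlongrightarrow> L) (at_right 0)"
    and bound: "AE t in lebesgue_on {0<..<T}. norm (w t) \<le> C * t powr \<rho>"
  shows False
proof -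
  have "((\<lambda>t. C * t powr (\<rho> - \<alpha>)) \<longlongrightarrow> 0) (at_right 0)"
    using assms(2) by real_asymp
  moreover have "((\<lambda>t. norm (w t /\<^sub>R t powr \<alpha>)) \<longlongrightarrow> norm L) (at_right 0)"
    by (rule tendsto_norm[OF lim])
  ultimately have "((\<lambda>t. norm (w t /\<^sub>R t powr \<alpha>) - C * t powr (\<rho> - \<alpha>)) \<longlongrightarrow> norm L - 0) (at_right 0)"
    by (intro tendsto_diff)
  hence "\<forall>\<^sub>F t in at_right 0. 0 < norm (w t /\<^sub>R t powr \<alpha>) - C * t powr (\<rho> - \<alpha>)"
    using assms(3) by (intro order_tendstoD(1)) auto
  then obtain d where d: "d > 0" "\<And>t. 0 < t \<Longrightarrow> t < d \<Longrightarrow> C * t powr (\<rho> - \<alpha>) < norm (w t /\<^sub>R t powr \<alpha>)"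
    unfolding eventually_at_right_field by auto
  define r where "r = min d T"
  have r: "r > 0" using d assms by (simp add: r_def)
  have big: "C * t powr \<rho> < norm (w t)" if "0 < t" "t < r" for t
  proof -
    have "C * t powr (\<rho> - \<alpha>) * t powr \<alpha> < norm (w t /\<^sub>R t powr \<alpha>) * t powr \<alpha>"
      using d(2)[of t] that by (intro mult_strict_right_mono) (auto simp: r_def)
    thus ?thesis using that by (simp add: powr_diff field_simps)
  qed
  have "AE t in lebesgue. t \<in> {0<..<T} \<longrightarrow> norm (w t) \<le> C * t powr \<rho>"
    using bound by (simp add: AE_restrict_space_iff)
  hence "AE t in lebesgue. t \<notin> {0<..<r}"
    by eventually_elim (use big in \<open>force simp: r_def\<close>)
  hence "{0<..<r} \<in> null_sets lebesgue"
    by (subst AE_iff_null_sets) auto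
  hence "emeasure lebesgue {0<..<r} = 0" by blast
  thus False using r by simp
qed

lemma C1_on_imp_continuous_on:
  assumes "C1_on T p"
  shows "continuous_on {0..T} p"
  using assms unfolding C1_on_def
  by (auto intro!: continuous_at_imp_continuous_on simp: continuous_on_eq_continuous_within differentiable_imp_continuous_within)

lemma difference_of_orders_asymptotics:
  fixes u v :: "real \<Rightarrow> 'a::real_normed_vector"
  assumes "\<alpha> < \<beta>"
    and u: "((\<lambda>t. u t /\<^sub>R t powr \<alpha>) \<longlongrightarrow> L) (at_right 0)"
    and v: "((\<lambda>t. v t /\<^sub>R t powr \<beta>) \<longlongrightarrow> K) (at_right 0)"
  shows "((\<lambda>t. (u t - v t) /\<^sub>R t powr \<alpha>) \<longlongrightarrow> L) (at_right 0)"
proof -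
  have "((\<lambda>t::real. t powr (\<beta> - \<alpha>)) \<longlongrightarrow> 0) (at_right 0)"
    using assms(1) by real_asymp
  from tendsto_diff[OF u tendsto_scaleR[OF this v]]
  have "((\<lambda>t. u t /\<^sub>R t powr \<alpha> - t powr (\<beta> - \<alpha>) *\<^sub>R (v t /\<^sub>R t powr \<beta>)) \<longlongrightarrow> L) (at_right 0)"
    by simp
  moreover have "\<forall>\<^sub>F t in at_right 0. u t /\<^sub>R t powr \<alpha> - t powr (\<beta> - \<alpha>) *\<^sub>R (v t /\<^sub>R t powr \<beta>)
      = (u t - v t) /\<^sub>R t powr \<alpha>"
    using eventually_at_right_less[of 0]
    by eventually_elim (simp add: scaleR_diff_right powr_diff field_simps)
  ultimately show ?thesis by (rule Lim_transform_eventually)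
qed

theorem theorem5p1:
  fixes smul :: "'k::{real_normed_field,euclidean_space} \<Rightarrow> 'x::{banach,second_countable_topology} \<Rightarrow> 'x"
    and ip :: "'x \<Rightarrow> 'x \<Rightarrow> 'k"
    and D :: "'x set" and A :: "'x \<Rightarrow> 'x"
    and lam :: "nat \<Rightarrow> real" and P :: "nat \<Rightarrow> 'x \<Rightarrow> 'x"
    and f \<psi> :: 'x and p\<^sub>0 :: 'k
    and p q w :: "real \<Rightarrow> 'k"
    and T M \<alpha>m \<alpha>p \<alpha> \<beta> \<rho> :: real
  assumes "T > 0"
    and "hilbert_space smul ip"
    and "linear_operator_on smul D A"
    and "closure D = UNIV"
    and "self_adjoint_operator ip D A"
    and "bounded_below_by ip D (\<lambda>x. - A x) (lam 0)"
    and "compact_resolvent smul D A"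
    and "spectral_decomposition smul ip D (\<lambda>x. - A x) lam P"
    and "0 < \<alpha>m" "\<alpha>m < \<alpha>p" "\<alpha>p < 1"
    and "p\<^sub>0 \<noteq> 0" "M > norm p\<^sub>0"
    and "\<psi> \<in> D" "p\<^sub>0 * ip f \<psi> \<noteq> 0"
    and "\<rho> \<in> {\<alpha>p<..<1}"
    and "p \<in> admissible_sources T p\<^sub>0 M" "q \<in> admissible_sources T p\<^sub>0 M"
    and "\<alpha> \<in> {\<alpha>m..\<alpha>p}" "\<beta> \<in> {\<alpha>m..\<alpha>p}"
    and "\<And>t. t \<in> {0<..<T} \<Longrightarrow>
           w t = observation smul ip lam P f \<psi> p \<alpha> t - observation smul ip lam P f \<psi> q \<beta> t"
  shows "(w \<in> H_space \<rho> T \<and> frac_deriv \<rho> T w \<in> Linf_space T \<longrightarrow> \<alpha> = \<beta>) \<and>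
         (\<alpha> \<noteq> \<beta> \<longrightarrow> \<not> frac_deriv_in_Linf \<rho> T w) \<and>
         (\<alpha> \<noteq> \<beta> \<longrightarrow> frac_deriv_Linf_norm \<rho> T w = \<infinity>)"
proof -
  interpret hilbert_space smul ip by fact
  define obs where "obs = observation smul ip lam P f \<psi>"
  have lim: "((\<lambda>t. obs r a t /\<^sub>R t powr a) \<longlongrightarrow> (p\<^sub>0 * ip f \<psi>) /\<^sub>R (a * Gamma a)) (at_right 0)"
    and L: "(p\<^sub>0 * ip f \<psi>) /\<^sub>R (a * Gamma a) \<noteq> 0"
    if r: "r \<in> admissible_sources T p\<^sub>0 M" and a: "a \<in> {\<alpha>m..\<alpha>p}" for r a
  proof -
    have a': "0 < a" "a \<le> 1" using a assms by auto
    have "continuous_on {0..T} r" "r 0 = p\<^sub>0"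
      using r by (auto simp: admissible_sources_def intro: C1_on_imp_continuous_on)
    thus "((\<lambda>t. obs r a t /\<^sub>R t powr a) \<longlongrightarrow> (p\<^sub>0 * ip f \<psi>) /\<^sub>R (a * Gamma a)) (at_right 0)"
      unfolding obs_def
      using observation_asymptotics[OF a' assms(1) _ assms(5,6,8,14)] by blast
    show "(p\<^sub>0 * ip f \<psi>) /\<^sub>R (a * Gamma a) \<noteq> 0"
      using assms(15) a' Gamma_real_pos[OF a'(1)] by (simp del: mult_eq_0_iff Gamma_real_pos)
  qed
  have main: "\<alpha> = \<beta>" if w: "w \<in> H_space \<rho> T" and g: "frac_deriv \<rho> T w \<in> Linf_space T"
  proof -
    have \<rho>: "\<rho> > 0" "\<alpha> < \<rho>" "\<beta> < \<rho>" using assms by auto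
    have "\<exists>g. g \<in> L2_space T \<and> (AE t in lebesgue_on {0<..<T}. w t = rl_integral \<rho> g t)"
      using w by (auto simp: H_space_def)
    from someI_ex[OF this]
    have AEw: "AE t in lebesgue_on {0<..<T}. w t = rl_integral \<rho> (frac_deriv \<rho> T w) t"
      by (simp add: frac_deriv_def)
    obtain C where C: "\<And>t. 0 < t \<Longrightarrow> t < T \<Longrightarrow> norm (rl_integral \<rho> (frac_deriv \<rho> T w) t) \<le> C * t powr \<rho>"
      using rl_integral_Linf_bound[OF \<rho>(1) g] by blast
    have "AE t in lebesgue_on {0<..<T}. t \<in> {0<..<T}"
      by (rule AE_I2) simp
    with AEw have bound: "AE t in lebesgue_on {0<..<T}. norm (obs p \<alpha> t - obs q \<beta> t) \<le> C * t powr \<rho>"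
      by eventually_elim (use C assms(21) in \<open>force simp: obs_def\<close>)
    show ?thesis
    proof (cases \<alpha> \<beta> rule: linorder_cases)
      case less
      from no_AE_bound_of_smaller_order[OF assms(1) \<rho>(2) L[OF assms(17,19)]
        difference_of_orders_asymptotics[OF less lim[OF assms(17,19)] lim[OF assms(18,20)]] bound]
      show ?thesis ..
    next
      case greater
      have "AE t in lebesgue_on {0<..<T}. norm (obs q \<beta> t - obs p \<alpha> t) \<le> C * t powr \<rho>"
        using bound by (simp add: norm_minus_commute)
      from no_AE_bound_of_smaller_order[OF assms(1) \<rho>(3) L[OF assms(18,20)]
        difference_of_orders_asymptotics[OF greater lim[OF assms(18,20)] lim[OF assms(17,19)]] this]
      show ?thesis ..
    qed
  qed
  thus ?thesis by (auto simp: frac_deriv_in_Linf_def frac_deriv_Linf_norm_def)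
qed

end
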